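(* Let $p \colon E \to B$ be a fibration, where $E$ and $E \times_B E$ are ANRs. Then $$\mathrm{TC}_g^{FH}[p \colon E\to B] = \mathrm{TC}^{FH}[p \colon E \to B] = \mathrm{TC}^{M}[p \colon E\to B].$$
   Context: Fibration means Hurewicz fibration, $I=[0,1]$; ANR means absolute neighborhood retract for metrizable spaces (in particular metrizable). For a fibration $p \colon E \to B$: $E \times_B E = \{(e_1,e_2)\in E\times E \mid p(e_1)=p(e_2)\}$ with diagonal $\Delta E = \{(e,e)\mid e\in E\}$; $E^I_B = \{\gamma \in E^I \mid p\circ\gamma \text{ is constant}\}$ (subspace of $E^I$ with compact-open topology); $\Pi \colon E^I_B \to E \times_B E$, $\Pi(\gamma) = (\gamma(0),\gamma(1))$, which is a fibration; $\mathrm{c}_e$ is the constant path at $e$. Sections are continuous; each invariant is $\infty$ if no such integer exists. $\mathrm{TC}^{M}[p \colon E\to B]$ (monoidal parametrized topological complexity) is the least nonnegative integer $k$ such that $E \times_B E$ may be covered by open subsets $U_0,\dots,U_k$, each containing $\Delta E$ and admitting a section $\sigma_i \colon U_i \to E^I_B$ of $\Pi$ with $\sigma_i(e,e) = \mathrm{c}_e$ for all $e \in E$. $\mathrm{TC}^{FH}[p \colon E\to B]$ (Fadell–Husseini monoidal) is the least nonnegative integer $k$ such that $E \times_B E$ may be covered by open subsets $U_0,\dots,U_k$, each admitting a section $\sigma_i \colon U_i \to E^I_B$ of $\Pi$, such that (1) $\Delta E \subseteq U_0$; (2) $\sigma_0(e,e) = \mathrm{c}_e$ for all $e \in E$; (3)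 $\Delta E \cap U_i = \emptyset$ for all $i \geq 1$. $\mathrm{TC}_g^{FH}[p \colon E\to B]$ is defined in the same way as $\mathrm{TC}^{FH}$ except that the covering sets are not required to be open. *)

theory Defs
  imports "HOL-Analysis.Analysis" "HOL-Library.Extended_Nat"
begin

section \<open>Absolute neighbourhood retracts\<close>

text \<open>
  An ANR for metrizable spaces is a metrizable space \<open>X\<close> whose image under every embedding as a
  closed subset of a metrizable space \<open>Z\<close> is a retract of one of its neighbourhoods in \<open>Z\<close>.  HOL cannot
  quantify over the type carrying \<open>Z\<close> inside a definition.  The type \<open>'a \<Rightarrow> real\<close> loses no
  generality: by the Kuratowski-Wojdyslawski theorem \<open>X\<close> embeds as a closed subset of a convex set
  of bounded functions \<open>'a \<Rightarrow> real\<close> with the supremum norm, and by Dugundji's extension theorem that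
  convex set is an absolute extensor for all metrizable spaces.  So a neighbourhood retraction in
  that one space makes \<open>X\<close> an absolute neighbourhood extensor, hence a neighbourhood retract in
  metrizable spaces over any type.
\<close>

definition ANR_space :: "'a topology \<Rightarrow> bool" where
  "ANR_space X \<longleftrightarrow>
     metrizable_space X \<and>
     (\<forall>(Z :: ('a \<Rightarrow> real) topology) f.
        metrizable_space Z \<and> embedding_map X Z f \<and> closedin Z (f ` topspace X) \<longrightarrow>
        (\<exists>W. openin Z W \<and> f ` topspace X \<subseteq> W \<and>
             (f ` topspace X) retract_of_space (subtopology Z W)))"


section \<open>Hurewicz fibrations\<close>

abbreviation unit_interval :: "real topology" where
  "unit_interval \<equiv> top_of_set {0..1}"

definition homotopy_lifting_property ::
    "'x topology \<Rightarrow> 'e topology \<Rightarrow> 'b topology \<Rightarrow> ('e \<Rightarrow> 'b) \<Rightarrow> bool" where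
  "homotopy_lifting_property X E B p \<longleftrightarrow>
     (\<forall>f H. continuous_map X E f \<and>
            continuous_map (prod_topology X unit_interval) B H \<and>
            (\<forall>x \<in> topspace X. H (x, 0) = p (f x)) \<longrightarrow>
        (\<exists>G. continuous_map (prod_topology X unit_interval) E G \<and>
             (\<forall>x \<in> topspace X. G (x, 0) = f x) \<and>
             (\<forall>x \<in> topspace X. \<forall>t \<in> {0..1}. p (G (x, t)) = H (x, t))))"

text \<open>
  The test spaces range over all topologies on \<open>'e \<times> (real \<Rightarrow> 'b)\<close>, the type carrying the universal
  test space (pairs of a point of \<open>E\<close> and a path in \<open>B\<close> starting below it).  The lemma
  \<open>hurewicz_fibration_lifting\<close> below shows that test spaces over any other type then come for free.
\<close>

definition hurewicz_fibration :: "'e topology \<Rightarrow> 'b topology \<Rightarrow> ('e \<Rightarrow> 'b) \<Rightarrow> bool" where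
  "hurewicz_fibration E B p \<longleftrightarrow>
     continuous_map E B p \<and>
     (\<forall>X :: ('e \<times> (real \<Rightarrow> 'b)) topology. homotopy_lifting_property X E B p)"


section \<open>Path spaces\<close>

text \<open>
  Paths are made unique as functions on \<open>real\<close> by requiring them to be \<open>undefined\<close> off \<open>[0,1]\<close>.
\<close>

definition paths :: "'a topology \<Rightarrow> (real \<Rightarrow> 'a) set" where
  "paths X = {\<gamma> \<in> extensional {0..1}. pathin X \<gamma>}"

text \<open>The compact-open topology.\<close>

definition path_space :: "'a topology \<Rightarrow> (real \<Rightarrow> 'a) topology" where
  "path_space X = topology_generated_by
     {{\<gamma> \<in> paths X. \<gamma> ` K \<subseteq> U} | K U. compactin unit_interval K \<and> openin X U}"

definition const_path :: "'a \<Rightarrow> real \<Rightarrow> 'a" where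
  "const_path x = (\<lambda>t\<in>{0..1}. x)"

lemma topspace_path_space [simp]: "topspace (path_space X) = paths X"
proof -
  have "paths X = {\<gamma> \<in> paths X. \<gamma> ` {} \<subseteq> {}}" "compactin unit_interval {}" "openin X {}"
    by auto
  then show ?thesis
    unfolding path_space_def topology_generated_by_topspace by blast
qed

lemma path_space_curry:
  assumes H: "continuous_map (prod_topology X unit_interval) B H"
  shows "continuous_map X (path_space B) (\<lambda>x. \<lambda>t\<in>{0..1}. H (x, t))" (is "continuous_map X _ ?h")
proof -
  have path: "?h x \<in> paths B" if "x \<in> topspace X" for x
  proof -
    have "continuous_map unit_interval (prod_topology X unit_interval) (\<lambda>t. (x, t))"
      using that by (simp add: continuous_map_pairwise o_def)
    then have "continuous_map unit_interval B (\<lambda>t. H (x, t))"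
      using H continuous_map_compose[of _ _ "\<lambda>t. (x, t)" B H] by (simp add: o_def)
    then have "pathin B (?h x)"
      unfolding pathin_def by (rule continuous_map_eq) simp
    then show ?thesis
      by (simp add: paths_def)
  qed
  show ?thesis
    unfolding path_space_def
  proof (rule continuous_on_generated_topo)
    fix S
    assume "S \<in> {{\<gamma> \<in> paths B. \<gamma> ` K \<subseteq> U} | K U. compactin unit_interval K \<and> openin B U}"
    then obtain K U where S: "S = {\<gamma> \<in> paths B. \<gamma> ` K \<subseteq> U}"
      and K: "compactin unit_interval K" and U: "openin B U"
      by auto
    have KI: "K \<subseteq> {0..1}"
      using K compactin_subset_topspace by fastforce
    let ?XK = "prod_topology X (subtopology unit_interval K)"
    let ?C = "{z \<in> topspace ?XK. H z \<in> topspace B - U}"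
    have "continuous_map ?XK B H"
      using continuous_map_from_subtopology[OF H, of "UNIV \<times> K"]
      by (simp add: subtopology_Times)
    then have "closedin ?XK ?C"
      using U by (intro closedin_continuous_map_preimage) auto
    moreover have "compact_space (subtopology unit_interval K)"
      using K by (simp add: compact_space_subtopology)
    ultimately have "closedin X (fst ` ?C)"
      using closed_map_fst[of "subtopology unit_interval K" X] by (auto simp: closed_map_def)
    moreover have "?h -` S \<inter> topspace X = topspace X - fst ` ?C"
    proof -
      have "H (x, t) \<in> topspace B" if "x \<in> topspace X" "t \<in> K" for x t
        using continuous_map_image_subset_topspace[OF H] that KI by auto
      then have "?h x \<in> S \<longleftrightarrow> x \<notin> fst ` ?C" if "x \<in> topspace X" for x
        using that KI path[OF that] by (auto simp: S image_subset_iff subset_iff image_iff)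
      then show ?thesis
        by blast
    qed
    ultimately show "openin X (?h -` S \<inter> topspace X)"
      by auto
  next
    show "?h ` topspace X \<subseteq>
        \<Union> {{\<gamma> \<in> paths B. \<gamma> ` K \<subseteq> U} | K U. compactin unit_interval K \<and> openin B U}"
      using path topspace_path_space[of B]
      unfolding path_space_def topology_generated_by_topspace by blast
  qed
qed

lemma path_space_eval:
  "continuous_map (prod_topology (path_space B) unit_interval) B (\<lambda>(\<gamma>, t). \<gamma> t)"
  unfolding continuous_map_def
proof (intro conjI allI impI)
  show "(\<lambda>(\<gamma>, t). \<gamma> t) \<in> topspace (prod_topology (path_space B) unit_interval) \<rightarrow> topspace B"
    by (auto simp: paths_def pathin_def continuous_map_def)
next
  fix U
  assume U: "openin B U"
  let ?P = "{z \<in> topspace (prod_topology (path_space B) unit_interval). (case z of (\<gamma>, t) \<Rightarrow> \<gamma> t) \<in> U}"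
  show "openin (prod_topology (path_space B) unit_interval) ?P"
  proof (subst openin_subopen, intro ballI)
    fix z
    assume "z \<in> ?P"
    then obtain \<gamma> t where z: "z = (\<gamma>, t)" and \<gamma>: "\<gamma> \<in> paths B" and t: "t \<in> {0..1}" "\<gamma> t \<in> U"
      by auto
    have "openin unit_interval {s \<in> {0..1}. \<gamma> s \<in> U}"
      using openin_continuous_map_preimage[OF _ U, of unit_interval \<gamma>] \<gamma>
      by (simp add: paths_def pathin_def)
    then obtain \<epsilon> where \<epsilon>: "\<epsilon> > 0" "cball t \<epsilon> \<inter> {0..1} \<subseteq> {s \<in> {0..1}. \<gamma> s \<in> U}"
      using t unfolding openin_contains_cball by auto
    define K where "K = cball t \<epsilon> \<inter> {0..1}"
    let ?V = "{\<delta> \<in> paths B. \<delta> ` K \<subseteq> U}"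
    let ?T = "ball t \<epsilon> \<inter> {0..1}"
    have "compactin unit_interval K"
      by (auto simp: K_def compactin_subtopology compact_Int)
    then have "openin (path_space B) ?V"
      unfolding path_space_def using U by (intro topology_generated_by_Basis) auto
    moreover have "openin unit_interval ?T"
      using openin_open_Int[of "ball t \<epsilon>" "{0..1}"] by (simp add: Int_commute)
    ultimately have "openin (prod_topology (path_space B) unit_interval) (?V \<times> ?T)"
      by (simp add: openin_prod_Times_iff)
    moreover have "z \<in> ?V \<times> ?T"
      using z \<gamma> t \<epsilon> by (auto simp: K_def)
    moreover have "?V \<times> ?T \<subseteq> ?P"
      by (auto simp: K_def)
    ultimately show "\<exists>T. openin (prod_topology (path_space B) unit_interval) T \<and> z \<in> T \<and> T \<subseteq> ?P"
      by blast
  qed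
qed

lemma hurewicz_fibration_lifting:
  fixes E :: "'e topology" and B :: "'b topology" and X :: "'x topology"
  assumes fib: "hurewicz_fibration E B p"
  shows "homotopy_lifting_property X E B p"
  unfolding homotopy_lifting_property_def
proof (intro allI impI, elim conjE)
  fix f H
  assume f: "continuous_map X E f"
    and H: "continuous_map (prod_topology X unit_interval) B H"
    and start: "\<forall>x \<in> topspace X. H (x, 0) = p (f x)"
  define \<Omega> where "\<Omega> = subtopology (prod_topology E (path_space B)) {(e, \<gamma>). \<gamma> 0 = p e}"
  let ?K = "\<lambda>((e, \<gamma>), t). \<gamma> t"
  define j where "j x = (f x, \<lambda>t\<in>{0..1}. H (x, t))" for x
  have top: "topspace \<Omega> = {(e, \<gamma>). e \<in> topspace E \<and> \<gamma> \<in> paths B \<and> \<gamma> 0 = p e}"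
    by (auto simp: \<Omega>_def)
  have fst: "continuous_map \<Omega> E fst"
    unfolding \<Omega>_def by (intro continuous_map_from_subtopology continuous_map_fst)
  have snd: "continuous_map \<Omega> (path_space B) snd"
    unfolding \<Omega>_def by (intro continuous_map_from_subtopology continuous_map_snd)
  have "continuous_map (prod_topology \<Omega> unit_interval) (prod_topology (path_space B) unit_interval)
          (\<lambda>z. (snd (fst z), snd z))"
    using continuous_map_compose[OF continuous_map_fst snd, of unit_interval]
    by (simp add: continuous_map_pairwise o_def continuous_map_snd)
  from continuous_map_compose[OF this path_space_eval]
  have K: "continuous_map (prod_topology \<Omega> unit_interval) B ?K"
    by (simp add: o_def case_prod_unfold)
  have "homotopy_lifting_property \<Omega> E B p"
    using fib by (simp add: hurewicz_fibration_def)
  then have "\<exists>G. continuous_map (prod_topology \<Omega> unit_interval) E G \<and>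
             (\<forall>w \<in> topspace \<Omega>. G (w, 0) = fst w) \<and>
             (\<forall>w \<in> topspace \<Omega>. \<forall>t \<in> {0..1}. p (G (w, t)) = ?K (w, t))"
    unfolding homotopy_lifting_property_def
    by (rule allE[of _ fst], elim allE[of _ ?K] mp) (use fst K in \<open>auto simp: top\<close>)
  then obtain G where G: "continuous_map (prod_topology \<Omega> unit_interval) E G"
      "\<And>w. w \<in> topspace \<Omega> \<Longrightarrow> G (w, 0) = fst w"
      "\<And>w t. w \<in> topspace \<Omega> \<Longrightarrow> t \<in> {0..1} \<Longrightarrow> p (G (w, t)) = ?K (w, t)"
    by blast
  have "continuous_map X (prod_topology E (path_space B)) j"
    using f path_space_curry[OF H] by (simp add: j_def continuous_map_pairwise o_def)
  then have j: "continuous_map X \<Omega> j"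
    unfolding \<Omega>_def by (rule continuous_map_into_subtopology) (auto simp: j_def start)
  then have jt: "j x \<in> topspace \<Omega>" if "x \<in> topspace X" for x
    using that by (auto simp: continuous_map_def)
  have "continuous_map (prod_topology X unit_interval) (prod_topology \<Omega> unit_interval)
          (\<lambda>z. (j (fst z), snd z))"
    using continuous_map_compose[OF continuous_map_fst j, of unit_interval]
    by (simp add: continuous_map_pairwise o_def continuous_map_snd)
  from continuous_map_compose[OF this G(1)]
  have "continuous_map (prod_topology X unit_interval) E (\<lambda>z. G (j (fst z), snd z))"
    by (simp add: o_def)
  then show "\<exists>G. continuous_map (prod_topology X unit_interval) E G \<and>
             (\<forall>x \<in> topspace X. G (x, 0) = f x) \<and>
             (\<forall>x \<in> topspace X. \<forall>t \<in> {0..1}. p (G (x, t)) = H (x, t))"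
    by (intro exI[of _ "\<lambda>z. G (j (fst z), snd z)"]) (auto simp: G(2,3)[OF jt], auto simp: j_def)
qed


section \<open>Parametrized topological complexity\<close>

definition fibre_square :: "'e topology \<Rightarrow> ('e \<Rightarrow> 'b) \<Rightarrow> ('e \<times> 'e) topology" where
  "fibre_square E p = subtopology (prod_topology E E) {(e1, e2). p e1 = p e2}"

definition diagonal :: "'e topology \<Rightarrow> ('e \<times> 'e) set" where
  "diagonal E = {(e, e) | e. e \<in> topspace E}"

definition vertical_path_space :: "'e topology \<Rightarrow> ('e \<Rightarrow> 'b) \<Rightarrow> (real \<Rightarrow> 'e) topology" where
  "vertical_path_space E p = subtopology (path_space E) {\<gamma>. (\<lambda>t. p (\<gamma> t)) constant_on {0..1}}"

definition endpoints :: "(real \<Rightarrow> 'e) \<Rightarrow> 'e \<times> 'e" where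
  "endpoints \<gamma> = (\<gamma> 0, \<gamma> 1)"

definition local_section ::
    "'e topology \<Rightarrow> ('e \<Rightarrow> 'b) \<Rightarrow> ('e \<times> 'e) set \<Rightarrow> ('e \<times> 'e \<Rightarrow> real \<Rightarrow> 'e) \<Rightarrow> bool" where
  "local_section E p U \<sigma> \<longleftrightarrow>
     continuous_map (subtopology (fibre_square E p) U) (vertical_path_space E p) \<sigma> \<and>
     (\<forall>u \<in> U. endpoints (\<sigma> u) = u)"

text \<open>In \<open>enat\<close> the infimum of the empty set is \<open>\<infinity>\<close>.\<close>

definition TC_M :: "'e topology \<Rightarrow> ('e \<Rightarrow> 'b) \<Rightarrow> enat" where
  "TC_M E p = Inf {enat k | k. \<exists>U \<sigma>.
     topspace (fibre_square E p) = (\<Union>i\<le>k. U i) \<and>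
     (\<forall>i\<le>k. openin (fibre_square E p) (U i) \<and> diagonal E \<subseteq> U i \<and>
             local_section E p (U i) (\<sigma> i) \<and>
             (\<forall>e \<in> topspace E. \<sigma> i (e, e) = const_path e))}"

definition FH_cover ::
    "'e topology \<Rightarrow> ('e \<Rightarrow> 'b) \<Rightarrow> nat \<Rightarrow> (nat \<Rightarrow> ('e \<times> 'e) set) \<Rightarrow> bool" where
  "FH_cover E p k U \<longleftrightarrow>
     topspace (fibre_square E p) = (\<Union>i\<le>k. U i) \<and>
     (\<exists>\<sigma>. (\<forall>i\<le>k. local_section E p (U i) (\<sigma> i)) \<and>
          diagonal E \<subseteq> U 0 \<and>
          (\<forall>e \<in> topspace E. \<sigma> 0 (e, e) = const_path e) \<and>
          (\<forall>i\<in>{1..k}. diagonal E \<inter> U i = {}))"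

definition TC_FH :: "'e topology \<Rightarrow> ('e \<Rightarrow> 'b) \<Rightarrow> enat" where
  "TC_FH E p = Inf {enat k | k. \<exists>U. (\<forall>i\<le>k. openin (fibre_square E p) (U i)) \<and> FH_cover E p k U}"

definition TC_g_FH :: "'e topology \<Rightarrow> ('e \<Rightarrow> 'b) \<Rightarrow> enat" where
  "TC_g_FH E p = Inf {enat k | k. \<exists>U. FH_cover E p k U}"

end

theory Submission
  imports Defs
begin

text \<open>
  The main point is that a section over an arbitrary subset \<open>A\<close> of \<open>E \<times>\<^sub>B E\<close>, constant on a closed part
  \<open>D\<close> of the diagonal, can be replaced by one over an open neighbourhood of \<open>A\<close>, still constant on \<open>D\<close>.
  A section sends \<open>z = (x, y)\<close> to a path from \<open>x\<close> to \<open>y\<close>, hence yields a homotopy in \<open>E \<times>\<^sub>B E\<close> from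
  \<open>(x, x)\<close> to \<open>(x, y)\<close>.  As \<open>E \<times>\<^sub>B E\<close> is an ANR, this homotopy extends, with the same ends, over an open
  neighbourhood.  The extension is no longer vertical in each coordinate, but running its first
  coordinate backwards and then its second one gives a path from \<open>x\<close> to \<open>y\<close> over a canonically
  contractible loop, and lifting the contraction makes it vertical.

  Open sets with \<open>U 0\<close> containing the diagonal and the others missing it are turned into sets that
  contain it by adding, to each shrunken \<open>U i\<close>, a disjoint neighbourhood of the diagonal on which the
  section over \<open>U 0\<close> is used; conversely one removes the diagonal from all sets but one.
\<close>

section \<open>Neighbourhood retractions in larger types\<close>

text \<open>An infinite set is equinumerous to its square.\<close>

lemma ex_inj_pair_real: "\<exists>f :: real \<times> real \<Rightarrow> real. inj f"
proof -
  have "\<exists>f. bij_betw f ((UNIV :: real set) \<times> (UNIV :: real set)) (UNIV :: real set)"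
    using card_of_Times_same_infinite[OF infinite_UNIV_char_0[where 'a = real]]
    unfolding card_of_ordIso .
  then show ?thesis
    by (auto simp: bij_betw_def)
qed

text \<open>Types are nonempty, so a coordinate \<open>a\<close> can be fixed, and the extra real is
  packed into the value there. This brings ambient spaces with one additional real coordinate within
  reach of \<open>ANR_space\<close>.\<close>

lemma ex_inj_fun_times_real: "\<exists>j :: ('a \<Rightarrow> real) \<times> real \<Rightarrow> ('a \<Rightarrow> real). inj j"
proof -
  obtain f :: "real \<times> real \<Rightarrow> real" where f: "inj f"
    using ex_inj_pair_real by blast
  fix a :: 'a
  have "inj (\<lambda>z. (fst z)(a := f (fst z a, snd z)))"
  proof (rule injI)
    fix z w :: "('a \<Rightarrow> real) \<times> real"
    assume eq: "(fst z)(a := f (fst z a, snd z)) = (fst w)(a := f (fst w a, snd w))"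
    from fun_cong[OF eq, of a] f have "fst z a = fst w a" "snd z = snd w"
      by (auto dest: injD)
    moreover have "fst z x = fst w x" if "x \<noteq> a" for x
      using fun_cong[OF eq, of x] that by simp
    ultimately show "z = w"
      by (metis ext prod_eqI)
  qed
  then show ?thesis by blast
qed

text \<open>An injection of the carrying type lets ambient spaces other than those over \<open>'a \<Rightarrow> real\<close> be used.\<close>

lemma ANR_space_neighbourhood_retract:
  fixes X :: "'a topology" and Z :: "'z topology" and j :: "'z \<Rightarrow> 'a \<Rightarrow> real"
  assumes X: "ANR_space X" and j: "inj j" and Z: "metrizable_space Z"
    and f: "embedding_map X Z f" "closedin Z (f ` topspace X)"
  obtains W r where "openin Z W" "f ` topspace X \<subseteq> W"
    "continuous_map (subtopology Z W) (subtopology Z (f ` topspace X)) r"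
    "\<And>x. x \<in> topspace X \<Longrightarrow> r (f x) = f x"
proof -
  \<comment> \<open>\<open>Z'\<close> is a homeomorphic copy of \<open>Z\<close> on
    \<open>range j\<close>, to which the definition of \<open>ANR_space\<close> applies. The
    retraction found there is carried back by \<open>inv j\<close>.\<close>
  define Z' where "Z' = pullback_topology (range j) (inv j) Z"
  have inv: "inv j (j z) = z" for z
    using j by simp
  have j': "continuous_map Z Z' j"
    unfolding Z'_def
    by (rule continuous_map_pullback') (auto simp: o_def inv simp flip: id_def)
  have i': "continuous_map Z' Z (inv j)"
    using continuous_map_pullback[of Z Z id "range j" "inv j"] by (simp add: Z'_def o_def)
  have top: "topspace Z' = j ` topspace Z"
    by (auto simp: Z'_def topspace_pullback_topology inv)
  have hm: "homeomorphic_maps Z Z' j (inv j)"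
    using j' i' by (auto simp: homeomorphic_maps_def top inv)
  then have hom: "homeomorphic_map Z Z' j"
    using homeomorphic_map_maps by blast
  have "metrizable_space Z'"
    using Z hom homeomorphic_map_imp_homeomorphic_space homeomorphic_metrizable_space by blast
  moreover have "embedding_map Z Z' j"
    using hom surjective_embedding_map by blast
  then have "embedding_map X Z' (j \<circ> f)"
    using f by (intro embedding_map_compose) auto
  moreover have "closedin Z' ((j \<circ> f) ` topspace X)"
    using homeomorphic_map_closedness_eq[OF hom] f by (simp add: image_comp)
  ultimately obtain W' where W': "openin Z' W'" "(j \<circ> f) ` topspace X \<subseteq> W'"
      and ret: "((j \<circ> f) ` topspace X) retract_of_space (subtopology Z' W')"
    using X unfolding ANR_space_def by blast
  from ret obtain r' where r': "continuous_map (subtopology Z' W') (subtopology (subtopology Z' W') ((j \<circ> f) ` topspace X)) r'"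
     "\<And>x. x \<in> (j \<circ> f) ` topspace X \<Longrightarrow> r' x = x"
    unfolding retract_of_space_def by blast
  define W where "W = {z \<in> topspace Z. j z \<in> W'}"
  show ?thesis
  proof
    show "openin Z W"
      unfolding W_def using j' W'(1) by (rule openin_continuous_map_preimage)
    show "f ` topspace X \<subseteq> W"
      using W'(2) f(2) closedin_subset by (fastforce simp: W_def)
    have "continuous_map (subtopology Z W) (subtopology Z' W') j"
      using j' by (auto simp: continuous_map_in_subtopology W_def intro: continuous_map_from_subtopology)
    moreover have "continuous_map (subtopology Z' W') (subtopology Z' ((j \<circ> f) ` topspace X)) r'"
      using r'(1) W'(2) by (simp add: subtopology_subtopology Int_absorb1)
    moreover have "continuous_map (subtopology Z' ((j \<circ> f) ` topspace X)) (subtopology Z (f ` topspace X)) (inv j)"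
      using i' by (auto simp: continuous_map_in_subtopology inv intro: continuous_map_from_subtopology)
    ultimately show "continuous_map (subtopology Z W) (subtopology Z (f ` topspace X)) (inv j \<circ> (r' \<circ> j))"
      by (meson continuous_map_compose)
    show "(inv j \<circ> (r' \<circ> j)) (f x) = f x" if "x \<in> topspace X" for x
      using r'(2)[of "j (f x)"] that inv by auto
  qed
qed

section \<open>Distance to a set\<close>

text \<open>The infimum is meaningful only for nonempty \<open>C\<close>, so the empty set is
  treated apart wherever the distance is applied.\<close>

definition set_dist :: "('a \<Rightarrow> 'a \<Rightarrow> real) \<Rightarrow> 'a set \<Rightarrow> 'a \<Rightarrow> real" where
  "set_dist d C x = (INF c\<in>C. d x c)"

context Metric_space
begin

lemma set_dist_nonneg: "C \<noteq> {} \<Longrightarrow> 0 \<le> set_dist d C x"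
  by (auto simp: set_dist_def intro: cINF_greatest)

lemma set_dist_le: "c \<in> C \<Longrightarrow> set_dist d C x \<le> d x c"
  unfolding set_dist_def by (rule cINF_lower) (auto intro: bdd_belowI[of _ 0])

lemma set_dist_less:
  assumes "C \<noteq> {}" "set_dist d C x < r" obtains c where "c \<in> C" "d x c < r"
  using assms unfolding set_dist_def by (subst (asm) cInf_less_iff) (auto intro: bdd_belowI[of _ 0])

lemma set_dist_triangle:
  assumes "C \<subseteq> M" "C \<noteq> {}" "x \<in> M" "y \<in> M"
  shows "set_dist d C x \<le> d x y + set_dist d C y"
proof -
  have "set_dist d C x - d x y \<le> d y c" if "c \<in> C" for c
    using set_dist_le[OF that, of x] triangle[of x y c] assms that by fastforce
  then have "set_dist d C x - d x y \<le> set_dist d C y"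
    unfolding set_dist_def[of _ _ y] using assms by (intro cINF_greatest) auto
  then show ?thesis by simp
qed

lemma set_dist_lipschitz:
  assumes "C \<subseteq> M" "C \<noteq> {}" "x \<in> M" "y \<in> M"
  shows "\<bar>set_dist d C x - set_dist d C y\<bar> \<le> d x y"
  using set_dist_triangle[of C x y] set_dist_triangle[of C y x] assms by (simp add: commute)

lemma continuous_map_set_dist:
  assumes "C \<subseteq> M" "C \<noteq> {}"
  shows "continuous_map mtopology euclideanreal (set_dist d C)"
proof -
  have "continuous_map mtopology Met_TC.mtopology (set_dist d C)"
    unfolding metric_continuous_map[OF Met_TC.Metric_space_axioms]
    using set_dist_lipschitz[OF assms] by (fastforce simp: dist_real_def)
  then show ?thesis by simp
qed

text \<open>For a point outside the closed set, the radius of a ball that misses \<open>C\<close> is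
  a positive lower bound of its distances to \<open>C\<close>.\<close>

lemma set_dist_pos:
  assumes "closedin mtopology C" "C \<noteq> {}" "x \<in> M"
  shows "0 < set_dist d C x \<longleftrightarrow> x \<notin> C"
proof
  show "x \<notin> C" if "0 < set_dist d C x"
    using that set_dist_le[of x C x] assms by force
  assume "x \<notin> C"
  then obtain r where r: "r > 0" "disjnt C (mball x r)"
    using assms unfolding closedin_metric by blast
  have "r \<le> d x c" if "c \<in> C" for c
    using r that assms closedin_subset[of _ C] by (force simp: disjnt_def)
  then have "r \<le> set_dist d C x"
    unfolding set_dist_def using assms by (intro cINF_greatest) auto
  then show "0 < set_dist d C x" using r by simp
qed

end

lemma metrizable_space_zero_set:
  assumes "metrizable_space X" "closedin X C"
  obtains u where "continuous_map X euclideanreal u" "\<And>x. x \<in> topspace X \<Longrightarrow> 0 \<le> u x"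
    "\<And>x. x \<in> topspace X \<Longrightarrow> u x = 0 \<longleftrightarrow> x \<in> C"
proof (cases "C = {}")
  case True
  then show ?thesis by (intro that[of "\<lambda>_. 1"]) auto
next
  case False
  obtain M d where "Metric_space M d" and X: "X = Metric_space.mtopology M d"
    using assms metrizable_space_def by blast
  then interpret Metric_space M d by simp
  have "C \<subseteq> M" using assms closedin_subset X by fastforce
  have C: "closedin mtopology C" using assms X by simp
  show ?thesis
  proof
    show "continuous_map X euclideanreal (set_dist d C)"
      unfolding X using \<open>C \<subseteq> M\<close> False by (rule continuous_map_set_dist)
    show "0 \<le> set_dist d C x" for x
      by (rule set_dist_nonneg[OF False])
    show "set_dist d C x = 0 \<longleftrightarrow> x \<in> C" if "x \<in> topspace X" for x
      using set_dist_pos[OF C False, of x] set_dist_nonneg[OF False, of x] that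
      unfolding X by auto
  qed
qed

section \<open>The Kuratowski embedding\<close>

text \<open>Truncation at 1 keeps the supremum finite for arbitrary functions, so the uniform metric
  lives on the whole type and not only on bounded functions.\<close>

definition uniform_dist :: "('a \<Rightarrow> real) \<Rightarrow> ('a \<Rightarrow> real) \<Rightarrow> real" where
  "uniform_dist v w = (SUP e. min 1 \<bar>v e - w e\<bar>)"

lemma uniform_dist_upper: "min 1 \<bar>v e - w e\<bar> \<le> uniform_dist v w"
  unfolding uniform_dist_def by (rule cSUP_upper) (auto intro: bdd_aboveI[of _ 1])

lemma uniform_dist_least: "(\<And>e. min 1 \<bar>v e - w e\<bar> \<le> r) \<Longrightarrow> uniform_dist v w \<le> r"
  unfolding uniform_dist_def by (rule cSUP_least) auto

interpretation uniform: Metric_space UNIV uniform_dist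
proof
  fix v w z :: "'a \<Rightarrow> real"
  fix e :: 'a
  show nonneg: "0 \<le> uniform_dist v w" for v w :: "'a \<Rightarrow> real"
    using uniform_dist_upper[of v e w] by linarith
  show "uniform_dist v w = uniform_dist w v"
    by (simp add: uniform_dist_def abs_minus_commute)
  show "uniform_dist v w = 0 \<longleftrightarrow> v = w"
  proof
    assume "uniform_dist v w = 0"
    then have "v e = w e" for e
      using uniform_dist_upper[of v e w] by (simp add: min_def split: if_splits)
    then show "v = w" by blast
  qed (simp add: uniform_dist_def)
  show "uniform_dist v z \<le> uniform_dist v w + uniform_dist w z"
  proof (rule uniform_dist_least)
    fix e
    have "min 1 \<bar>v e - z e\<bar> \<le> min 1 \<bar>v e - w e\<bar> + min 1 \<bar>w e - z e\<bar>"
      by linarith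
    then show "min 1 \<bar>v e - z e\<bar> \<le> uniform_dist v w + uniform_dist w z"
      using uniform_dist_upper[of v e w] uniform_dist_upper[of w e z] by linarith
  qed
qed

text \<open>Cutting the distance functions off at 1 gives values in [0,1], as the extension formula
  requires, without choosing a base point. Coordinates outside \<open>M\<close> are set to 0 because
  \<open>d\<close> has no meaning there.\<close>

definition kuratowski :: "'a set \<Rightarrow> ('a \<Rightarrow> 'a \<Rightarrow> real) \<Rightarrow> 'a \<Rightarrow> 'a \<Rightarrow> real" where
  "kuratowski M d x e = (if e \<in> M then min 1 (d x e) else 0)"

context Metric_space
begin

lemma kuratowski_bounds: "0 \<le> kuratowski M d x e" "kuratowski M d x e \<le> 1"
  by (auto simp: kuratowski_def)

lemma kuratowski_lipschitz:
  assumes "x \<in> M" "y \<in> M"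
  shows "\<bar>kuratowski M d x e - kuratowski M d y e\<bar> \<le> min 1 (d x y)"
proof (cases "e \<in> M")
  case True
  then have "d x e \<le> d x y + d y e" "d y e \<le> d x y + d x e"
    using triangle[of x y e] triangle[of y x e] assms by (simp_all add: commute)
  with True show ?thesis
    using nonneg[of x e] nonneg[of y e] nonneg[of x y] unfolding kuratowski_def if_P[OF True] by linarith
qed (simp add: kuratowski_def)

text \<open>The triangle inequality gives the upper bound. It is attained in the coordinate
  \<open>y\<close>, where \<open>kuratowski M d y\<close> vanishes.\<close>

lemma uniform_dist_kuratowski:
  assumes "x \<in> M" "y \<in> M"
  shows "uniform_dist (kuratowski M d x) (kuratowski M d y) = min 1 (d x y)"
proof (rule antisym)
  show "uniform_dist (kuratowski M d x) (kuratowski M d y) \<le> min 1 (d x y)"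
    using kuratowski_lipschitz[OF assms] by (intro uniform_dist_least) (metis min.coboundedI2)
  show "min 1 (d x y) \<le> uniform_dist (kuratowski M d x) (kuratowski M d y)"
    using uniform_dist_upper[of "kuratowski M d x" y "kuratowski M d y"] assms
    by (simp add: kuratowski_def)
qed

lemma embedding_map_kuratowski: "embedding_map mtopology uniform.mtopology (kuratowski M d)"
proof -
  let ?k = "kuratowski M d"
  interpret k: Submetric UNIV uniform_dist "?k ` M"
    by unfold_locales auto
  have inj: "inj_on ?k M"
  proof (rule inj_onI)
    fix x y assume "x \<in> M" "y \<in> M" "?k x = ?k y"
    then show "x = y"
      using uniform_dist_kuratowski[of x y] by (simp add: min_def split: if_splits)
  qed
  let ?g = "inv_into M ?k"
  have "continuous_map mtopology uniform.mtopology ?k"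
    unfolding metric_continuous_map[OF uniform.Metric_space_axioms]
    using uniform_dist_kuratowski by fastforce
  then have "continuous_map mtopology (subtopology uniform.mtopology (?k ` M)) ?k"
    by (simp add: continuous_map_in_subtopology)
  moreover have "continuous_map (Metric_space.mtopology (?k ` M) uniform_dist) mtopology ?g"
    unfolding k.sub.metric_continuous_map[OF Metric_space_axioms]
  proof (intro conjI ballI allI impI)
    show "?g ` ?k ` M \<subseteq> M" using inj by auto
    fix a and \<epsilon> :: real assume a: "a \<in> ?k ` M" "0 < \<epsilon>"
    show "\<exists>\<delta>>0. \<forall>x. x \<in> ?k ` M \<and> uniform_dist a x < \<delta> \<longrightarrow> d (?g a) (?g x) < \<epsilon>"
    \<comment> \<open>Below 1 the truncation has no effect, so a small uniform distance bounds
      \<open>d\<close> itself.\<close>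
    proof (intro exI[of _ "min 1 \<epsilon>"] conjI allI impI)
      fix x assume "x \<in> ?k ` M \<and> uniform_dist a x < min 1 \<epsilon>"
      with a inj show "d (?g a) (?g x) < \<epsilon>"
        by (auto simp: uniform_dist_kuratowski)
    qed (use a in auto)
  qed
  then have "continuous_map (subtopology uniform.mtopology (?k ` M)) mtopology ?g"
    by (simp add: k.mtopology_submetric)
  ultimately have "homeomorphic_maps mtopology (subtopology uniform.mtopology (?k ` M)) ?k ?g"
    using inj by (auto simp: homeomorphic_maps_def f_inv_into_f)
  then show ?thesis
    unfolding embedding_map_def homeomorphic_map_maps by auto
qed

end

section \<open>Extending function-valued maps by Hausdorff's formula\<close>

lemma abs_INF_diff_le:
  fixes f g :: "'a \<Rightarrow> real"
  assumes "C \<noteq> {}" "bdd_below (f ` C)" "bdd_below (g ` C)"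
    and le: "\<And>c. c \<in> C \<Longrightarrow> \<bar>f c - g c\<bar> \<le> r"
  shows "\<bar>(INF c\<in>C. f c) - (INF c\<in>C. g c)\<bar> \<le> r"
proof -
  have "(INF c\<in>C. f c) - r \<le> g c" if "c \<in> C" for c
    using cINF_lower[OF assms(2) that] le[OF that] by linarith
  then have "(INF c\<in>C. f c) - r \<le> (INF c\<in>C. g c)"
    by (rule cINF_greatest[OF assms(1)])
  moreover have "(INF c\<in>C. g c) - r \<le> f c" if "c \<in> C" for c
    using cINF_lower[OF assms(3) that] le[OF that] by linarith
  then have "(INF c\<in>C. g c) - r \<le> (INF c\<in>C. f c)"
    by (rule cINF_greatest[OF assms(1)])
  ultimately show ?thesis by linarith
qed

text \<open>
  In the coordinatewise variant of Hausdorff's extension formula below, where \<open>r\<close> is the distance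
  from \<open>x\<close> to \<open>C\<close>, the penalty discards the points of \<open>C\<close> that are far from \<open>x\<close>.  All estimates are
  uniform in the coordinate \<open>e\<close>, which gives continuity for the uniform metric.
\<close>

definition penalty :: "real \<Rightarrow> real \<Rightarrow> real" where
  "penalty r t = max 0 (min t (3 * r) / r - 2)"

lemma penalty_nonneg: "0 \<le> penalty r t"
  by (simp add: penalty_def)

lemma penalty_near: "r > 0 \<Longrightarrow> t \<le> 2 * r \<Longrightarrow> penalty r t = 0"
  by (simp add: penalty_def field_simps)

lemma penalty_far: "r > 0 \<Longrightarrow> t \<ge> 3 * r \<Longrightarrow> penalty r t = 1"
  by (simp add: penalty_def)

text \<open>The cap \<open>3 * r\<close> bounds the quotient by 3. The change of the numerator and
  that of the denominator then contribute at most \<open>3 * \<delta> / r\<close> each.\<close>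

lemma penalty_lipschitz:
  assumes r: "r > 0" "r' > 0" and t: "t' \<ge> 0" "\<bar>r - r'\<bar> \<le> \<delta>" "\<bar>t - t'\<bar> \<le> \<delta>"
  shows "\<bar>penalty r t - penalty r' t'\<bar> \<le> 6 * \<delta> / r"
proof -
  define a b where "a = min t (3 * r)" and "b = min t' (3 * r')"
  have ab: "\<bar>a - b\<bar> \<le> 3 * \<delta>" "0 \<le> b" "b \<le> 3 * r'"
    using r t by (auto simp: a_def b_def min_def)
  have "\<bar>penalty r t - penalty r' t'\<bar> \<le> \<bar>a / r - b / r'\<bar>"
    unfolding penalty_def a_def b_def by linarith
  also have "a / r - b / r' = (a - b) / r + (b / r') * (r' - r) / r"
    using r by (simp add: field_simps)
  also have "\<bar>\<dots>\<bar> \<le> \<bar>a - b\<bar> / r + (b / r') * \<bar>r' - r\<bar> / r"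
    using r ab abs_triangle_ineq[of "(a - b) / r" "(b / r') * (r' - r) / r"]
    by (simp add: abs_mult)
  also have "\<dots> \<le> 3 * \<delta> / r + 3 * \<delta> / r"
  proof (intro add_mono divide_right_mono)
    have "b / r' \<le> 3" using ab r by (simp add: field_simps)
    then show "b / r' * \<bar>r' - r\<bar> \<le> 3 * \<delta>"
      using t by (intro mult_mono) auto
  qed (use ab r in auto)
  also have "\<dots> = 6 * \<delta> / r"
    by (simp flip: add_divide_distrib)
  finally show ?thesis .
qed

context Metric_space
begin

definition hausdorff_extension :: "'a set \<Rightarrow> ('a \<Rightarrow> 'e \<Rightarrow> real) \<Rightarrow> 'a \<Rightarrow> 'e \<Rightarrow> real" where
  "hausdorff_extension C f x e =
     (if x \<in> C then f x e else INF c\<in>C. f c e + penalty (set_dist d C x) (d x c))"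

lemma continuous_map_hausdorff_extension:
  fixes f :: "'a \<Rightarrow> 'e \<Rightarrow> real"
  assumes C: "closedin mtopology C" "C \<noteq> {}"
    and f: "continuous_map (subtopology mtopology C) uniform.mtopology f"
    and bounds: "\<And>c e. c \<in> C \<Longrightarrow> 0 \<le> f c e" "\<And>c e. c \<in> C \<Longrightarrow> f c e \<le> 1"
  shows "continuous_map mtopology uniform.mtopology (hausdorff_extension C f)"
proof -
  let ?F = "hausdorff_extension C f"
  have CM: "C \<subseteq> M" using C closedin_subset by fastforce
  have bdd: "bdd_below ((\<lambda>c. f c e + penalty (set_dist d C x) (d x c)) ` C)" for x e
    using bounds penalty_nonneg by (intro bdd_belowI2[of _ 0]) (simp add: add_nonneg_nonneg)
  interpret C: Submetric M d C
    using CM by unfold_locales auto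
  have fC: "\<exists>\<delta>>0. \<forall>c\<in>C. d a c < \<delta> \<longrightarrow> uniform_dist (f a) (f c) < \<epsilon>" if "a \<in> C" "\<epsilon> > 0" for a \<epsilon>
  proof -
    have "\<forall>a\<in>C. \<forall>\<epsilon>>0. \<exists>\<delta>>0. \<forall>c. c \<in> C \<and> d a c < \<delta> \<longrightarrow> uniform_dist (f a) (f c) < \<epsilon>"
      using f unfolding C.mtopology_submetric[symmetric]
        C.sub.metric_continuous_map[OF uniform.Metric_space_axioms] by simp
    with that show ?thesis by meson
  qed
  show ?thesis
    unfolding metric_continuous_map[OF uniform.Metric_space_axioms]
  proof (intro conjI ballI allI impI)
    fix a and \<epsilon> :: real
    assume a: "a \<in> M" and \<epsilon>: "0 < \<epsilon>"
    show "\<exists>\<delta>>0. \<forall>x. x \<in> M \<and> d a x < \<delta> \<longrightarrow> uniform_dist (?F a) (?F x) < \<epsilon>"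
    proof (cases "a \<in> C")
      case True
      \<comment> \<open>As \<open>\<eta> < 1\<close>, a bound on the truncated differences is a
        bound on the differences themselves.\<close>
      define \<eta> where "\<eta> = min 1 \<epsilon> / 2"
      have \<eta>: "0 < \<eta>" "\<eta> < \<epsilon>" "\<eta> < 1" using \<epsilon> by (auto simp: \<eta>_def min_def)
      obtain \<delta> where \<delta>: "\<delta> > 0" "\<And>c. c \<in> C \<Longrightarrow> d a c < \<delta> \<Longrightarrow> uniform_dist (f a) (f c) < \<eta>"
        using fC[OF True \<eta>(1)] by blast
      have near: "\<bar>f a e - f c e\<bar> \<le> \<eta>" if "c \<in> C" "d a c < \<delta>" for c e
        using \<delta>(2)[OF that] uniform_dist_upper[of "f a" e "f c"] \<eta> by (auto simp: min_def split: if_splits)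
      \<comment> \<open>Since \<open>a\<close> lies in \<open>C\<close>, the distance from
        \<open>x\<close> to \<open>C\<close> is at most \<open>d a x\<close>. Points of
        \<open>C\<close> closer to \<open>x\<close> than three times that distance are within
        \<open>4 * d a x < \<delta>\<close> of \<open>a\<close>, so \<open>near\<close> applies to
        them.\<close>
      have "uniform_dist (?F a) (?F x) \<le> \<eta>" if x: "x \<in> M" "d a x < \<delta> / 4" for x
      proof (rule uniform_dist_least)
        fix e
        show "min 1 \<bar>?F a e - ?F x e\<bar> \<le> \<eta>"
        proof (cases "x \<in> C")
          case xC: True
          then show ?thesis
            using near[of x e] x \<delta> True by (simp add: hausdorff_extension_def)
        next
          case False
          let ?r = "set_dist d C x"
          let ?g = "\<lambda>c. f c e + penalty ?r (d x c)"
          have r: "0 < ?r" using set_dist_pos[OF C x(1)] False by simp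
          have ra: "?r \<le> d a x" using set_dist_le[OF True, of x] by (simp add: commute)
          have tri: "d a c \<le> d a x + d x c" if "c \<in> C" for c
            using triangle a x that CM by blast
          \<comment> \<open>A point of \<open>C\<close> within twice the distance is not penalized,
            hence bounds the infimum from above.\<close>
          obtain c where c: "c \<in> C" "d x c < 2 * ?r"
            using set_dist_less[OF C(2), of x "2 * ?r"] r by auto
          have "(INF c\<in>C. ?g c) \<le> f c e"
            using cINF_lower[OF bdd c(1), of e x] penalty_near[OF r, of "d x c"] c by simp
          moreover have "\<bar>f a e - f c e\<bar> \<le> \<eta>"
            using tri[OF c(1)] c(2) ra x(2) nonneg[of a x] by (intro near[OF c(1)]) linarith
          moreover have "f a e - \<eta> \<le> ?g c" if cC: "c \<in> C" for c
          proof (cases "d x c < 3 * ?r")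
            case True
            then have "\<bar>f a e - f c e\<bar> \<le> \<eta>"
              using tri[OF cC] ra x(2) nonneg[of a x] by (intro near[OF cC]) linarith
            then show ?thesis using penalty_nonneg[of ?r "d x c"] by linarith
          next
            case False
            \<comment> \<open>For far points the full penalty 1 already exceeds the wanted bound,
              because \<open>f\<close> takes values in [0,1].\<close>
            then have "penalty ?r (d x c) = 1" using penalty_far[OF r] by simp
            then show ?thesis
              using bounds(1)[OF cC, of e] bounds(2)[OF True, of e] \<eta> by linarith
          qed
          then have "f a e - \<eta> \<le> (INF c\<in>C. ?g c)"
            using C(2) by (intro cINF_greatest)
          ultimately have "\<bar>f a e - (INF c\<in>C. ?g c)\<bar> \<le> \<eta>" by linarith
          then show ?thesis using False True by (simp add: hausdorff_extension_def)
        qed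
      qed
      then show ?thesis
        using \<delta>(1) \<eta> by (intro exI[of _ "\<delta> / 4"]) fastforce
    next
      case False
      define r where "r = set_dist d C a"
      have r: "r > 0" using set_dist_pos[OF C a] False by (simp add: r_def)
      \<comment> \<open>The bound \<open>r\<close> keeps \<open>x\<close> outside \<open>C\<close>;
        the other bound makes the Lipschitz estimate \<open>6 * \<eta> / r\<close> at most half of
        \<open>\<epsilon>\<close>.\<close>
      define \<eta> where "\<eta> = min r (\<epsilon> * r / 12)"
      have \<eta>: "\<eta> > 0" "\<eta> \<le> r" "6 * \<eta> / r < \<epsilon>"
        using r \<epsilon> by (auto simp: \<eta>_def min_def field_simps)
      have "uniform_dist (?F a) (?F x) \<le> 6 * \<eta> / r" if x: "x \<in> M" "d a x < \<eta>" for x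
      proof (rule uniform_dist_least)
        fix e
        have xC: "x \<notin> C"
          using set_dist_le[of x C a] x \<eta> by (auto simp: r_def)
        then have r': "0 < set_dist d C x" using set_dist_pos[OF C x(1)] by simp
        have "\<bar>?F a e - ?F x e\<bar> \<le> 6 * \<eta> / r"
          using False xC unfolding hausdorff_extension_def
        proof (simp, intro abs_INF_diff_le[OF C(2) bdd bdd])
          fix c assume c: "c \<in> C"
          have "\<bar>penalty (set_dist d C a) (d a c) - penalty (set_dist d C x) (d x c)\<bar> \<le> 6 * \<eta> / r"
            unfolding r_def
          proof (rule penalty_lipschitz)
            show "\<bar>set_dist d C a - set_dist d C x\<bar> \<le> \<eta>"
              using set_dist_lipschitz[OF CM C(2) a x(1)] x by simp
            show "\<bar>d a c - d x c\<bar> \<le> \<eta>"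
              using triangle[of a x c] triangle[of x a c] a x c CM by (auto simp: commute)
          qed (use r r' in \<open>auto simp: r_def\<close>)
          then show "\<bar>f c e + penalty (set_dist d C a) (d a c) - (f c e + penalty (set_dist d C x) (d x c))\<bar> \<le> 6 * \<eta> / r"
            by simp
        qed
        then show "min 1 \<bar>?F a e - ?F x e\<bar> \<le> 6 * \<eta> / r" by linarith
      qed
      then show ?thesis using \<eta> by (intro exI[of _ \<eta>]) fastforce
    qed
  qed auto
qed

end

section \<open>Extension of maps and homotopies into an ANR\<close>

text \<open>A copy of \<open>X\<close> is placed at height 0 in a space \<open>Z\<close> that has no
  constraint at positive heights. Then \<open>f\<close> extends over all of \<open>Y\<close> as a
  map into \<open>Z\<close>: Hausdorff's formula gives the function coordinate and the distance to
  \<open>C\<close> the height. Near \<open>C\<close> the values lie in the domain of a neighbourhood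
  retraction onto \<open>X\<close>, which is applied to them.\<close>

proposition ANR_space_neighbourhood_extension:
  fixes X :: "'a topology" and Y :: "'b topology"
  assumes X: "ANR_space X" and Y: "metrizable_space Y" and C: "closedin Y C"
    and f: "continuous_map (subtopology Y C) X f"
  obtains W g where "openin Y W" "C \<subseteq> W" "continuous_map (subtopology Y W) X g"
    "\<And>c. c \<in> C \<Longrightarrow> g c = f c"
proof (cases "C = {}")
  case True
  then show ?thesis by (intro that[of "{}" f]) auto
next
  case False
  obtain M d where "Metric_space M d" and Xd: "X = Metric_space.mtopology M d"
    using X unfolding ANR_space_def metrizable_space_def by blast
  then interpret X: Metric_space M d by simp
  obtain N d' where "Metric_space N d'" and Yd: "Y = Metric_space.mtopology N d'"
    using Y unfolding metrizable_space_def by blast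
  then interpret Y: Metric_space N d' by simp
  have topX: "topspace X = M" by (simp add: Xd)
  have CN: "C \<subseteq> N" using C closedin_subset Yd by fastforce
  have C': "closedin Y.mtopology C" using C Yd by simp
  let ?k = "kuratowski M d"
  have k: "embedding_map X uniform.mtopology ?k"
    unfolding Xd by (rule X.embedding_map_kuratowski)
  \<comment> \<open>The last coordinate makes the copy of \<open>X\<close> at height 0 closed, although its image in the space
    of functions need not be.\<close>
  define Z where "Z = subtopology (prod_topology uniform.mtopology euclideanreal)
     {(v, s). s > 0 \<or> s = 0 \<and> v \<in> ?k ` M}"
  have kc: "continuous_map X uniform.mtopology ?k"
    using k embedding_map_def continuous_map_in_subtopology homeomorphic_imp_continuous_map by blast
  obtain ki where ki: "homeomorphic_maps X (subtopology uniform.mtopology (?k ` topspace X)) ?k ki"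
    using k unfolding embedding_map_def homeomorphic_map_maps by blast
  let ?i = "\<lambda>x. (?k x, 0 :: real)"
  have Z: "metrizable_space Z"
    unfolding Z_def
    by (intro metrizable_space_subtopology)
       (simp add: metrizable_space_prod_topology uniform.metrizable_space_mtopology metrizable_space_euclidean)
  have ic: "continuous_map X Z ?i"
    unfolding Z_def continuous_map_in_subtopology
    using kc by (auto simp: continuous_map_pairwise o_def Xd)
  have kii: "continuous_map (subtopology Z (?i ` topspace X)) X (ki \<circ> fst)"
  proof (rule continuous_map_compose)
    show "continuous_map (subtopology Z (?i ` topspace X)) (subtopology uniform.mtopology (?k ` topspace X)) fst"
      unfolding continuous_map_in_subtopology Z_def
      by (auto simp: topX intro: continuous_map_from_subtopology continuous_map_fst)
    show "continuous_map (subtopology uniform.mtopology (?k ` topspace X)) X ki"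
      using ki by (simp add: homeomorphic_maps_def)
  qed
  have emb: "embedding_map X Z ?i"
    unfolding embedding_map_def homeomorphic_map_maps homeomorphic_maps_def
  proof (intro exI[of _ "ki \<circ> fst"] conjI)
    show "continuous_map X (subtopology Z (?i ` topspace X)) ?i"
      using ic by (simp add: continuous_map_in_subtopology)
    show "continuous_map (subtopology Z (?i ` topspace X)) X (ki \<circ> fst)"
      by (rule kii)
    show eq: "\<forall>x \<in> topspace X. (ki \<circ> fst) (?i x) = x"
      using ki by (simp add: homeomorphic_maps_def)
    show "\<forall>z \<in> topspace (subtopology Z (?i ` topspace X)). ?i ((ki \<circ> fst) z) = z"
      using eq by auto
  qed
  have "closedin (prod_topology uniform.mtopology euclideanreal) (UNIV \<times> {0})"
    by (simp add: closedin_prod_Times_iff)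
  then have "closedin Z ({(v, s). s > 0 \<or> s = 0 \<and> v \<in> ?k ` M} \<inter> (UNIV \<times> {0}))"
    unfolding Z_def by (rule closedin_subtopology_Int_closed)
  also have "{(v, s). s > 0 \<or> s = 0 \<and> v \<in> ?k ` M} \<inter> (UNIV \<times> {0}) = ?i ` topspace X"
    by (auto simp: topX)
  finally have closed: "closedin Z (?i ` topspace X)" .
  obtain j :: "('a \<Rightarrow> real) \<times> real \<Rightarrow> 'a \<Rightarrow> real" where "inj j"
    using ex_inj_fun_times_real by blast
  from ANR_space_neighbourhood_retract[OF X this Z emb closed]
  obtain W r where W: "openin Z W" "?i ` topspace X \<subseteq> W"
    and r: "continuous_map (subtopology Z W) (subtopology Z (?i ` topspace X)) r"
      "\<And>x. x \<in> topspace X \<Longrightarrow> r (?i x) = ?i x" by blast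
  have fX: "f c \<in> M" if "c \<in> C" for c
    using f that CN by (force simp: continuous_map_def Yd Xd)
  define F where "F = (\<lambda>y. (Y.hausdorff_extension C (?k \<circ> f) y, set_dist d' C y))"
  have "continuous_map Y uniform.mtopology (Y.hausdorff_extension C (?k \<circ> f))"
    unfolding Yd
  proof (rule Y.continuous_map_hausdorff_extension[OF C' False])
    show "continuous_map (subtopology Y.mtopology C) uniform.mtopology (?k \<circ> f)"
      using continuous_map_compose[OF f kc] by (simp add: Yd)
  qed (auto simp: X.kuratowski_bounds)
  moreover have "continuous_map Y euclideanreal (set_dist d' C)"
    unfolding Yd using CN False by (rule Y.continuous_map_set_dist)
  moreover have FC: "F c = ?i (f c)" if "c \<in> C" for c
    using that CN Y.set_dist_pos[OF C' False, of c] Y.set_dist_nonneg[OF False, of c]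
    by (auto simp: F_def Y.hausdorff_extension_def)
  moreover have "0 < set_dist d' C y" if "y \<in> N" "y \<notin> C" for y
    using Y.set_dist_pos[OF C' False] that by simp
  ultimately have F: "continuous_map Y Z F"
    unfolding Z_def continuous_map_in_subtopology
    using fX by (auto simp: continuous_map_pairwise o_def F_def Yd)
  define V where "V = {y \<in> topspace Y. F y \<in> W}"
  show ?thesis
  proof
    show "openin Y V"
      unfolding V_def using F W(1) by (rule openin_continuous_map_preimage)
    show "C \<subseteq> V"
      using W(2) FC fX CN by (auto simp: V_def Yd Xd)
    have "continuous_map (subtopology Y V) (subtopology Z W) F"
      using F by (auto simp: continuous_map_in_subtopology V_def intro: continuous_map_from_subtopology)
    from continuous_map_compose[OF continuous_map_compose[OF this r(1)] kii]
    show "continuous_map (subtopology Y V) X (ki \<circ> fst \<circ> (r \<circ> F))" .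
    show "(ki \<circ> fst \<circ> (r \<circ> F)) c = f c" if "c \<in> C" for c
      using FC[OF that] r(2)[of "f c"] fX[OF that] ki by (auto simp: homeomorphic_maps_def Xd)
  qed
qed

section \<open>Extending homotopies from arbitrary subsets\<close>

lemma openin_compact_slices:
  assumes "compact_space K" "openin (prod_topology X K) W"
  shows "openin X {x \<in> topspace X. \<forall>k \<in> topspace K. (x, k) \<in> W}"
proof -
  \<comment> \<open>The complement of the set in question is the projection of a closed set along
    the compact factor, and such projections are closed maps.\<close>
  have "closedin (prod_topology X K) (topspace (prod_topology X K) - W)"
    using assms(2) by blast
  then have "closedin X (fst ` (topspace (prod_topology X K) - W))"
    using closed_map_fst[OF assms(1)] unfolding closed_map_def by blast
  moreover have "{x \<in> topspace X. \<forall>k \<in> topspace K. (x, k) \<in> W}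
      = topspace X - fst ` (topspace (prod_topology X K) - W)"
    by force
  ultimately show ?thesis by auto
qed

lemma compact_space_unit_interval: "compact_space unit_interval"
  by (simp add: compact_space_subtopology)

text \<open>The function is half the distance from \<open>(x, 0)\<close> to the complement of
  \<open>N\<close>, cut off at 1, and \<open>V\<close> is where that distance is positive. If the
  complement is empty, the constant 1 serves.\<close>

lemma ex_continuous_below_open:
  assumes X: "metrizable_space X" and N: "openin (prod_topology X unit_interval) N"
  obtains V \<phi> where "openin X V" "\<And>x. x \<in> topspace X \<Longrightarrow> (x, 0) \<in> N \<Longrightarrow> x \<in> V"
    "continuous_map (subtopology X V) euclideanreal \<phi>"
    "\<And>x. x \<in> V \<Longrightarrow> 0 < \<phi> x \<and> \<phi> x \<le> 1 \<and> (x, \<phi> x) \<in> N"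
proof -
  define K where "K = topspace (prod_topology X unit_interval) - N"
  have K: "closedin (prod_topology X unit_interval) K"
    unfolding K_def using N by blast
  show ?thesis
  proof (cases "K = {}")
    case True
    then have "(x, 1) \<in> N" if "x \<in> topspace X" for x
      using that by (auto simp: K_def)
    then show ?thesis
      by (intro that[of "topspace X" "\<lambda>_. 1"]) auto
  next
    case False
    obtain M d where "Metric_space M d" and Xd: "X = Metric_space.mtopology M d"
      using X metrizable_space_def by blast
    then interpret Metric_space M d by simp
    interpret I: Submetric "UNIV :: real set" dist "{0..1}" by unfold_locales auto
    interpret P: Metric_space12 M d "{0..1 :: real}" dist ..
    define D where "D = prod_dist d (dist :: real \<Rightarrow> real \<Rightarrow> real)"
    have top: "P.Prod_metric.mtopology = prod_topology X unit_interval"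
      using I.mtopology_submetric by (simp add: P.mtopology_prod_metric Xd)
    have K': "closedin P.Prod_metric.mtopology K" using K top by simp
    have KM: "K \<subseteq> M \<times> {0..1}" using closedin_subset[OF K] by (auto simp: Xd)
    define r where "r x = set_dist D K (x, 0)" for x
    have r: "0 < r x \<longleftrightarrow> (x, 0) \<in> N" if "x \<in> M" for x
      using P.Prod_metric.set_dist_pos[OF K' False, of "(x, 0)"] that
      unfolding r_def D_def by (auto simp: K_def Xd)
    have "continuous_map X (prod_topology X unit_interval) (\<lambda>x. (x, 0 :: real))"
      by (simp add: continuous_map_pairwise o_def)
    moreover have "continuous_map (prod_topology X unit_interval) euclideanreal (set_dist D K)"
      using P.Prod_metric.continuous_map_set_dist[OF KM False] unfolding top D_def .
    ultimately have rc: "continuous_map X euclideanreal r"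
      unfolding r_def using continuous_map_compose by (force simp: o_def)
    define V where "V = {x \<in> topspace X. r x \<in> {0<..}}"
    show ?thesis
    proof
      show "openin X V"
        unfolding V_def using rc by (rule openin_continuous_map_preimage) auto
      show "x \<in> V" if "x \<in> topspace X" "(x, 0) \<in> N" for x
        using r that by (auto simp: V_def Xd)
      show "continuous_map (subtopology X V) euclideanreal (\<lambda>x. min 1 (r x / 2))"
        using rc by (intro continuous_intros continuous_map_from_subtopology) auto
      show "0 < min 1 (r x / 2) \<and> min 1 (r x / 2) \<le> 1 \<and> (x, min 1 (r x / 2)) \<in> N" if "x \<in> V" for x
      proof -
        let ?t = "min 1 (r x / 2)"
        have x: "x \<in> M" "0 < r x" using that by (auto simp: V_def Xd)
        \<comment> \<open>In the product metric a vertical displacement has its own length, here at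
          most half of \<open>r x\<close>.\<close>
        have "D (x, 0) (x, ?t) < r x"
          using x by (simp add: D_def prod_dist_def)
        then have "(x, ?t) \<notin> K"
          using P.Prod_metric.set_dist_le[of "(x, ?t)" K "(x, 0)"] unfolding r_def D_def by auto
        then show ?thesis using x by (auto simp: K_def Xd)
      qed
    qed
  qed
qed

text \<open>
  \<open>A\<close> need not be closed in \<open>X\<close>, but \<open>A \<times> {0}\<close> is closed in \<open>T = A \<times> {0} \<union> X \<times> (0, 1]\<close>.  The data
  are extended to a neighbourhood in \<open>T \<times> [0, 1]\<close>, and the result is read off at a small positive
  height \<open>\<phi> x\<close>.
\<close>

proposition ANR_space_homotopy_extension:
  fixes X :: "'x topology" and Z :: "'z topology"
  assumes Z: "ANR_space Z" and X: "metrizable_space X"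
    and A: "A \<subseteq> topspace X" and D: "closedin X D" "D \<subseteq> A"
    and f0: "continuous_map X Z f0" and f1: "continuous_map X Z f1"
    and h: "continuous_map (prod_topology (subtopology X A) unit_interval) Z h"
    and h0: "\<And>x. x \<in> A \<Longrightarrow> h (x, 0) = f0 x" and h1: "\<And>x. x \<in> A \<Longrightarrow> h (x, 1) = f1 x"
    and hD: "\<And>x t. x \<in> D \<Longrightarrow> t \<in> {0..1} \<Longrightarrow> h (x, t) = f1 x"
  obtains V H where "openin X V" "A \<subseteq> V"
    "continuous_map (prod_topology (subtopology X V) unit_interval) Z H"
    "\<And>x. x \<in> V \<Longrightarrow> H (x, 0) = f0 x" "\<And>x. x \<in> V \<Longrightarrow> H (x, 1) = f1 x"
    "\<And>x t. x \<in> D \<Longrightarrow> t \<in> {0..1} \<Longrightarrow> H (x, t) = f1 x"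
proof -
  define T where "T = subtopology (prod_topology X unit_interval) {(x, t). t = 0 \<longrightarrow> x \<in> A}"
  let ?Q = "prod_topology T unit_interval"
  have Q: "metrizable_space ?Q"
    using X by (simp add: T_def metrizable_space_prod_topology metrizable_space_subtopology metrizable_space_euclidean)
  have topT: "topspace T = {(x, t). x \<in> topspace X \<and> t \<in> {0..1} \<and> (t = 0 \<longrightarrow> x \<in> A)}"
    by (auto simp: T_def)
  have x: "continuous_map ?Q X (\<lambda>q. fst (fst q))"
    unfolding T_def by (intro continuous_map_compose[OF continuous_map_fst, unfolded o_def]
        continuous_map_from_subtopology continuous_map_fst)
  have t: "continuous_map ?Q unit_interval (\<lambda>q. snd (fst q))"
    unfolding T_def by (intro continuous_map_compose[OF continuous_map_fst, unfolded o_def]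
        continuous_map_from_subtopology continuous_map_snd)
  have s: "continuous_map ?Q unit_interval snd"
    by (rule continuous_map_snd)
  \<comment> \<open>Points of \<open>?Q\<close> have the form ((x, height), time). Height 0 carries
    \<open>h\<close>, time 0 carries \<open>f0\<close>, and time 1 together with everything over
    \<open>D\<close> carries \<open>f1\<close>. The last two pieces cover all heights, so their
    conditions survive when the height is changed to \<open>\<phi> x\<close>.\<close>
  define P where "P = (\<lambda>i :: nat. if i = 0 then {q \<in> topspace ?Q. snd (fst q) \<in> {0}}
     else if i = 1 then {q \<in> topspace ?Q. snd q \<in> {0}}
     else {q \<in> topspace ?Q. snd q \<in> {1}} \<union> {q \<in> topspace ?Q. fst (fst q) \<in> D})"
  have [simp]: "closedin unit_interval {0}" "closedin unit_interval {1}"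
    by (auto intro: closed_subset)
  have "closedin ?Q {q \<in> topspace ?Q. snd (fst q) \<in> {0}}"
    "closedin ?Q {q \<in> topspace ?Q. snd q \<in> {0}}" "closedin ?Q {q \<in> topspace ?Q. snd q \<in> {1}}"
    by (rule closedin_continuous_map_preimage[OF t] closedin_continuous_map_preimage[OF s], simp)+
  moreover have "closedin ?Q {q \<in> topspace ?Q. fst (fst q) \<in> D}"
    using x D(1) by (rule closedin_continuous_map_preimage)
  ultimately have P: "closedin ?Q (P i)" for i
    unfolding P_def by (simp only: closedin_Un split: if_split) blast
  define F where "F = (\<lambda>i :: nat. \<lambda>q :: ('x \<times> real) \<times> real. if i = 0 then h (fst (fst q), snd q)
     else if i = 1 then f0 (fst (fst q)) else f1 (fst (fst q)))"
  let ?C = "P 0 \<union> P 1 \<union> P 2"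
  have C: "closedin ?Q ?C" using P by (intro closedin_Un)
  have "continuous_map (subtopology ?Q (P i)) Z (F i)" if i: "i \<in> {0, 1, 2}" for i
  proof -
    have x': "continuous_map (subtopology ?Q S) X (\<lambda>q. fst (fst q))" for S
      using x by (rule continuous_map_from_subtopology)
    consider "i = 0" | "i = 1" | "i = 2" using i by auto
    then show ?thesis
    proof cases
      case 1
      have "continuous_map (subtopology ?Q (P 0)) (prod_topology (subtopology X A) unit_interval)
              (\<lambda>q. (fst (fst q), snd q))"
        using x' s by (auto simp: continuous_map_pairwise o_def continuous_map_in_subtopology
            P_def topT intro: continuous_map_from_subtopology)
      from continuous_map_compose[OF this h] show ?thesis
        by (simp add: 1 F_def o_def)
    next
      case 2
      from continuous_map_compose[OF x' f0] show ?thesis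
        by (simp add: 2 F_def o_def)
    next
      case 3
      from continuous_map_compose[OF x' f1] show ?thesis
        by (simp add: 3 F_def o_def)
    qed
  qed
  moreover have "?C \<inter> P i = P i" if "i \<in> {0, 1, 2}" for i
    using that by auto
  ultimately have cont: "continuous_map (subtopology (subtopology ?Q ?C) (P i)) Z (F i)"
    if "i \<in> {0, 1, 2}" for i
    using that by (simp only: subtopology_subtopology)
  have clo: "closedin (subtopology ?Q ?C) (P i)" if "i \<in> {0, 1, 2}" for i
    using that P by (auto intro!: closedin_subset_topspace)
  \<comment> \<open>\<open>P 1\<close> and \<open>P 2\<close> meet only over \<open>D\<close>, where
    stationarity of \<open>h\<close> makes the two end maps agree.\<close>
  have f01: "f0 x = f1 x" if "x \<in> D" for x
    using hD[OF that, of 0] h0[of x] that D by auto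
  have agree: "F i q = F j q" if "i \<in> {0, 1, 2}" "j \<in> {0, 1, 2}" "q \<in> topspace (subtopology ?Q ?C) \<inter> P i \<inter> P j" for i j q
    using that h0 h1 hD f01 by (auto simp: F_def P_def topT)
  have cover: "topspace (subtopology ?Q ?C) \<subseteq> \<Union> (P ` {0, 1, 2})"
    by auto
  obtain f where f: "continuous_map (subtopology ?Q ?C) Z f"
     "\<And>i q. i \<in> {0, 1, 2} \<Longrightarrow> q \<in> P i \<Longrightarrow> q \<in> topspace ?Q \<Longrightarrow> f q = F i q"
  proof (rule pasting_lemma_exists_closed[of "{0, 1, 2 :: nat}" _ P, OF _ cover clo cont agree])
    fix f
    assume f: "continuous_map (subtopology ?Q ?C) Z f"
      "\<And>q i. i \<in> {0, 1, 2} \<Longrightarrow> q \<in> topspace (subtopology ?Q ?C) \<inter> P i \<Longrightarrow> f q = F i q"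
    show thesis
      by (rule that[OF f(1)]) (use f(2) in auto)
  qed auto
  obtain W g where W: "openin ?Q W" "?C \<subseteq> W" and g: "continuous_map (subtopology ?Q W) Z g"
      "\<And>q. q \<in> ?C \<Longrightarrow> g q = f q"
    using ANR_space_neighbourhood_extension[OF Z Q C f(1)] by blast
  have gF: "g q = F i q" if "i \<in> {0, 1, 2}" "q \<in> P i" for i q
  proof -
    have "q \<in> topspace ?Q" using that closedin_subset[OF P] by blast
    then show ?thesis using that f(2)[OF that] g(2)[of q] by auto
  qed
  \<comment> \<open>The points whose whole time interval stays in \<open>W\<close>; by compactness
    they form an open set.\<close>
  let ?N = "{y \<in> topspace T. \<forall>s \<in> topspace unit_interval. (y, s) \<in> W}"
  have "openin T ?N"
    using openin_compact_slices[OF compact_space_unit_interval W(1)] .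
  then obtain N where N: "openin (prod_topology X unit_interval) N"
      "?N = N \<inter> {(x, t). t = 0 \<longrightarrow> x \<in> A}"
    unfolding T_def openin_subtopology by blast
  obtain V \<phi> where V: "openin X V" "\<And>x. x \<in> topspace X \<Longrightarrow> (x, 0) \<in> N \<Longrightarrow> x \<in> V"
    and \<phi>: "continuous_map (subtopology X V) euclideanreal \<phi>"
      "\<And>x. x \<in> V \<Longrightarrow> 0 < \<phi> x \<and> \<phi> x \<le> 1 \<and> (x, \<phi> x) \<in> N"
    using ex_continuous_below_open[OF X N(1)] by blast
  have VX: "V \<subseteq> topspace X" using V(1) openin_subset by blast
  let ?e = "\<lambda>z. ((fst z, \<phi> (fst z)), snd z)"
  have e: "?e (x, s) \<in> W \<inter> topspace ?Q" if "x \<in> V" "s \<in> {0..1}" for x s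
  proof -
    \<comment> \<open>Positivity of \<open>\<phi> x\<close> puts the point into \<open>T\<close>
      even when \<open>x\<close> is not in \<open>A\<close>.\<close>
    have "(x, \<phi> x) \<in> ?N" using \<phi>(2)[OF that(1)] unfolding N(2) by auto
    then show ?thesis using that by auto
  qed
  show ?thesis
  proof
    show "openin X V" by fact
    show "A \<subseteq> V"
    proof
      fix a assume a: "a \<in> A"
      have "((a, 0), s) \<in> P 0" if "s \<in> {0..1}" for s
        using a A that by (auto simp: P_def topT)
      then have "(a, 0) \<in> ?N" using W(2) a A by (auto simp: topT)
      then show "a \<in> V" using V(2) a A N(2) by blast
    qed
    have 1: "continuous_map (prod_topology (subtopology X V) unit_interval) (subtopology X V) fst"
      by (rule continuous_map_fst)
    have "continuous_map (prod_topology (subtopology X V) unit_interval) (prod_topology (prod_topology X unit_interval) unit_interval) ?e"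
      using continuous_map_compose[OF 1 \<phi>(1)] 1 \<phi>(2)
        continuous_map_into_fulltopology[OF continuous_map_snd, of "subtopology X V" euclideanreal "{0..1}"]
      by (auto simp: continuous_map_pairwise o_def continuous_map_in_subtopology continuous_map_snd less_imp_le)
    moreover have "?e \<in> topspace (prod_topology (subtopology X V) unit_interval) \<rightarrow> topspace ?Q"
      using e by fastforce
    ultimately have "continuous_map (prod_topology (subtopology X V) unit_interval) ?Q ?e"
      unfolding T_def using \<phi>(2)
      by (auto simp: continuous_map_pairwise o_def continuous_map_in_subtopology)
    then have "continuous_map (prod_topology (subtopology X V) unit_interval) (subtopology ?Q W) ?e"
      using e by (auto simp: continuous_map_in_subtopology)
    from continuous_map_compose[OF this g(1)]
    show "continuous_map (prod_topology (subtopology X V) unit_interval) Z (g \<circ> ?e)" .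
    show "(g \<circ> ?e) (x, 0) = f0 x" if "x \<in> V" for x
      using gF[of 1 "?e (x, 0)"] e[OF that, of 0] by (simp add: P_def F_def)
    show "(g \<circ> ?e) (x, 1) = f1 x" if "x \<in> V" for x
      using gF[of 2 "?e (x, 1)"] e[OF that, of 1] by (simp add: P_def F_def)
    show "(g \<circ> ?e) (x, t) = f1 x" if "x \<in> D" "t \<in> {0..1}" for x t
      using gF[of 2 "?e (x, t)"] e[of x t] that D \<open>A \<subseteq> V\<close> by (auto simp: P_def F_def)
  qed
qed

section \<open>Lifting with prescribed stationary points\<close>

text \<open>
  Running the homotopy over \<open>x\<close> in time \<open>u x\<close> instead of 1 and slowing the lift down again makes
  the lift stationary where \<open>u\<close> vanishes.
\<close>

lemma homotopy_lifting_property_relative: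
  assumes lift: "homotopy_lifting_property X E B p"
    and u: "continuous_map X euclideanreal u" "\<And>x. x \<in> topspace X \<Longrightarrow> 0 \<le> u x \<and> u x \<le> 1"
    and f: "continuous_map X E f"
    and H: "continuous_map (prod_topology X unit_interval) B H"
    and H0: "\<And>x. x \<in> topspace X \<Longrightarrow> H (x, 0) = p (f x)"
    and stat: "\<And>x t. x \<in> topspace X \<Longrightarrow> u x = 0 \<Longrightarrow> t \<in> {0..1} \<Longrightarrow> H (x, t) = H (x, 0)"
  obtains G where "continuous_map (prod_topology X unit_interval) E G"
    "\<And>x. x \<in> topspace X \<Longrightarrow> G (x, 0) = f x"
    "\<And>x t. x \<in> topspace X \<Longrightarrow> t \<in> {0..1} \<Longrightarrow> p (G (x, t)) = H (x, t)"
    "\<And>x t. x \<in> topspace X \<Longrightarrow> u x = 0 \<Longrightarrow> t \<in> {0..1} \<Longrightarrow> G (x, t) = f x"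
proof -
  let ?XI = "prod_topology X unit_interval"
  \<comment> \<open>Where \<open>u\<close> vanishes, the division yields 0; the value is irrelevant as \<open>H\<close> is stationary there.\<close>
  define \<theta> where "\<theta> = (\<lambda>z. (fst z, min 1 (snd z / u (fst z))))"
  have \<theta>: "\<theta> z \<in> topspace ?XI" if "z \<in> topspace ?XI" for z
    using that u(2) by (auto simp: \<theta>_def)
  have uf: "continuous_map ?XI euclideanreal (\<lambda>z. u (fst z))"
    using continuous_map_compose[OF continuous_map_fst u(1)] by (simp add: o_def)
  have snd: "continuous_map ?XI euclideanreal snd"
    by (rule continuous_map_into_fulltopology[OF continuous_map_snd])
  let ?P = "{z \<in> topspace ?XI. u (fst z) \<in> {0<..}}"
  have oP: "openin ?XI ?P"
    using uf by (rule openin_continuous_map_preimage) auto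
  have "continuous_map (subtopology ?XI ?P) euclideanreal (\<lambda>z. min 1 (snd z / u (fst z)))"
    using uf snd by (intro continuous_intros continuous_map_from_subtopology) auto
  then have "continuous_map (subtopology ?XI ?P) ?XI \<theta>"
    using \<theta> u(2)
    by (fastforce simp: \<theta>_def continuous_map_pairwise o_def continuous_map_in_subtopology
        intro: continuous_map_from_subtopology continuous_map_fst)
  from continuous_map_compose[OF this H]
  have HP: "continuous_map (subtopology ?XI ?P) B (H \<circ> \<theta>)" .
  \<comment> \<open>The quotient in \<open>\<theta>\<close> may be discontinuous where
    \<open>u\<close> vanishes. There \<open>H\<close> is stationary, so an open set containing one
    value contains the whole slice, and by compactness also the slices over nearby points, however
    time is reparametrized.\<close>
  have H': "continuous_map ?XI B (H \<circ> \<theta>)"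
    unfolding continuous_map_def
  proof (intro conjI allI impI)
    show "H \<circ> \<theta> \<in> topspace ?XI \<rightarrow> topspace B"
      using \<theta> H unfolding continuous_map_def by fastforce
  next
    fix O' assume O': "openin B O'"
    let ?S = "{x \<in> topspace X. \<forall>k \<in> topspace unit_interval. (x, k) \<in> {z \<in> topspace ?XI. H z \<in> O'}}"
    let ?R = "{z \<in> topspace (subtopology ?XI ?P). (H \<circ> \<theta>) z \<in> O'}"
    have "openin X ?S"
      by (rule openin_compact_slices[OF compact_space_unit_interval openin_continuous_map_preimage[OF H O']])
    then have "openin ?XI (?S \<times> {0..1})"
      by (simp add: openin_prod_Times_iff)
    moreover have "openin ?XI ?R"
      using openin_continuous_map_preimage[OF HP O'] oP by (rule openin_trans_full)
    moreover have "{z \<in> topspace ?XI. (H \<circ> \<theta>) z \<in> O'} = ?S \<times> {0..1} \<union> ?R"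
    proof (intro equalityI subsetI)
      fix z assume z: "z \<in> {z \<in> topspace ?XI. (H \<circ> \<theta>) z \<in> O'}"
      then obtain x t where xt: "z = (x, t)" "x \<in> topspace X" "t \<in> {0..1}" by auto
      show "z \<in> ?S \<times> {0..1} \<union> ?R"
      proof (cases "u x = 0")
        case True
        then have "H (x, k) \<in> O'" if "k \<in> {0..1}" for k
          using z stat[OF xt(2) True that] by (simp add: \<theta>_def xt)
        then show ?thesis using xt by auto
      next
        case False
        then show ?thesis using xt z u(2)[OF xt(2)] by auto
      qed
    next
      fix z assume "z \<in> ?S \<times> {0..1} \<union> ?R"
      then show "z \<in> {z \<in> topspace ?XI. (H \<circ> \<theta>) z \<in> O'}"
        using \<theta>[of z] by (auto simp: \<theta>_def)
    qed
    ultimately show "openin ?XI {z \<in> topspace ?XI. (H \<circ> \<theta>) z \<in> O'}"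
      by (simp only: openin_Un)
  qed
  have "\<forall>x \<in> topspace X. (H \<circ> \<theta>) (x, 0) = p (f x)"
    using H0 by (simp add: \<theta>_def)
  with f H' lift[unfolded homotopy_lifting_property_def, THEN spec, of f, THEN spec, of "H \<circ> \<theta>", THEN mp]
  obtain G where G: "continuous_map ?XI E G"
      "\<And>x. x \<in> topspace X \<Longrightarrow> G (x, 0) = f x"
      "\<And>x t. x \<in> topspace X \<Longrightarrow> t \<in> {0..1} \<Longrightarrow> p (G (x, t)) = (H \<circ> \<theta>) (x, t)"
    by blast
  let ?m = "\<lambda>z. (fst z, u (fst z) * snd z)"
  have m: "u x * t \<in> {0..1}" if "x \<in> topspace X" "t \<in> {0..1}" for x t
    using u(2)[OF that(1)] that(2) by (auto intro: mult_nonneg_nonneg mult_le_one)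
  show ?thesis
  proof
    have "continuous_map ?XI ?XI ?m"
      using uf snd m by (auto simp: continuous_map_pairwise o_def continuous_map_in_subtopology
          continuous_map_fst intro!: continuous_map_real_mult)
    from continuous_map_compose[OF this G(1)]
    show "continuous_map ?XI E (G \<circ> ?m)" .
    show "(G \<circ> ?m) (x, 0) = f x" if "x \<in> topspace X" for x
      using G(2)[OF that] by simp
    show "p ((G \<circ> ?m) (x, t)) = H (x, t)" if "x \<in> topspace X" "t \<in> {0..1}" for x t
    proof (cases "u x = 0")
      case True
      then show ?thesis
        using G(3)[OF that(1), of 0] stat[OF that(1) True that(2)] by (simp add: \<theta>_def)
    next
      case False
      then show ?thesis
        using G(3)[OF that(1) m[OF that]] that(2) by (simp add: \<theta>_def)
    qed
    show "(G \<circ> ?m) (x, t) = f x" if "x \<in> topspace X" "u x = 0" "t \<in> {0..1}" for x t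
      using G(2)[OF that(1)] that(2) by simp
  qed
qed

text \<open>
  The path \<open>h\<inverse> \<cdot> k\<close> lies over a loop of the form \<open>b\<inverse> \<cdot> b\<close>, which contracts relative to its end points.
  Lifting the contraction relative to the end points and to \<open>D\<close> makes the path vertical.
\<close>

lemma vertical_path_of_double_path:
  fixes E :: "'e topology" and Y :: "'y topology"
  assumes fib: "hurewicz_fibration E B p" and Y: "metrizable_space Y" and D: "closedin Y D"
    and h: "continuous_map (prod_topology Y unit_interval) E h"
    and k: "continuous_map (prod_topology Y unit_interval) E k"
    and hk: "\<And>y t. y \<in> topspace Y \<Longrightarrow> t \<in> {0..1} \<Longrightarrow> p (h (y, t)) = p (k (y, t))"
    and h01: "\<And>y. y \<in> topspace Y \<Longrightarrow> h (y, 0) = k (y, 0)"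
    and ends: "\<And>y. y \<in> topspace Y \<Longrightarrow> p (h (y, 1)) = p (h (y, 0))"
    and const: "\<And>y t. y \<in> D \<Longrightarrow> t \<in> {0..1} \<Longrightarrow> h (y, t) = h (y, 0) \<and> k (y, t) = h (y, 0)"
  obtains \<sigma> where "continuous_map Y (vertical_path_space E p) \<sigma>"
    "\<And>y. y \<in> topspace Y \<Longrightarrow> endpoints (\<sigma> y) = (h (y, 1), k (y, 1))"
    "\<And>y. y \<in> D \<Longrightarrow> \<sigma> y = const_path (h (y, 0))"
proof -
  let ?YI = "prod_topology Y unit_interval"
  obtain v where v: "continuous_map Y euclideanreal v" "\<And>y. y \<in> topspace Y \<Longrightarrow> 0 \<le> v y"
    "\<And>y. y \<in> topspace Y \<Longrightarrow> v y = 0 \<longleftrightarrow> y \<in> D"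
    using metrizable_space_zero_set[OF Y D] by blast
  have snd: "continuous_map ?YI euclideanreal snd"
    by (rule continuous_map_into_fulltopology[OF continuous_map_snd])
  have vf: "continuous_map ?YI euclideanreal (\<lambda>z. v (fst z))"
    using continuous_map_compose[OF continuous_map_fst v(1)] by (simp add: o_def)
  have pc: "continuous_map E B p"
    using fib by (simp add: hurewicz_fibration_def)
  let ?a = "\<lambda>z. (fst z, 1 - 2 * snd z)" and ?b = "\<lambda>z. (fst z, 2 * snd z - 1)"
  define \<gamma> where "\<gamma> = (\<lambda>z. if snd z \<le> 1/2 then h (?a z) else k (?b z))"
  have \<gamma>: "continuous_map ?YI E \<gamma>"
    unfolding \<gamma>_def
  proof (rule continuous_map_cases_le[OF snd])
    show "continuous_map ?YI euclideanreal (\<lambda>z. 1/2)" by simp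
    have "continuous_map (subtopology ?YI {z \<in> topspace ?YI. snd z \<le> 1/2}) ?YI ?a"
      using continuous_map_from_subtopology[OF snd]
      by (auto simp: continuous_map_pairwise o_def continuous_map_in_subtopology
          intro!: continuous_intros continuous_map_from_subtopology[OF continuous_map_fst])
    from continuous_map_compose[OF this h]
    show "continuous_map (subtopology ?YI {z \<in> topspace ?YI. snd z \<le> 1/2}) E (\<lambda>z. h (?a z))"
      by (simp add: o_def)
    have "continuous_map (subtopology ?YI {z \<in> topspace ?YI. 1/2 \<le> snd z}) ?YI ?b"
      using continuous_map_from_subtopology[OF snd]
      by (auto simp: continuous_map_pairwise o_def continuous_map_in_subtopology
          intro!: continuous_intros continuous_map_from_subtopology[OF continuous_map_fst])
    from continuous_map_compose[OF this k]
    show "continuous_map (subtopology ?YI {z \<in> topspace ?YI. 1/2 \<le> snd z}) E (\<lambda>z. k (?b z))"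
      by (simp add: o_def)
    show "h (?a z) = k (?b z)" if "z \<in> topspace ?YI" "snd z = 1/2" for z
    proof -
      have z: "fst z \<in> topspace Y" "?a z = (fst z, 0)" "?b z = (fst z, 0)"
        using that by auto
      show ?thesis unfolding z(2,3) by (rule h01[OF z(1)])
    qed
  qed
  \<comment> \<open>By \<open>hk\<close>, the path \<open>\<gamma>\<close> lies over
    \<open>p (h (y, \<bar>2 * s - 1\<bar>))\<close>. Taking the maximum with \<open>\<tau>\<close>
    moves the turning point of this loop up to its start: the ends never move, and at
    \<open>\<tau> = 1\<close> only the point below \<open>h (y, 1)\<close> remains.\<close>
  define H where "H = (\<lambda>(z, \<tau>). p (h (fst z, max \<bar>2 * snd z - 1\<bar> \<tau>)))"
  \<comment> \<open>Vanishing exactly over \<open>D\<close> and at the two ends of the path,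
    \<open>u\<close> makes the lift keep the end points and the constant paths.\<close>
  define u where "u z = min 1 (v (fst z)) * (snd z * (1 - snd z))" for z :: "'y \<times> real"
  have u0: "u z = 0 \<longleftrightarrow> fst z \<in> D \<or> snd z = 0 \<or> snd z = 1" if "z \<in> topspace ?YI" for z
    using that v(2,3)[of "fst z"] by (auto simp: u_def min_def split: if_splits)
  have "continuous_map (prod_topology ?YI unit_interval) euclideanreal (\<lambda>w. snd (fst w))"
       "continuous_map (prod_topology ?YI unit_interval) euclideanreal snd"
    using continuous_map_compose[OF continuous_map_fst snd]
    by (auto simp: o_def intro: continuous_map_into_fulltopology[OF continuous_map_snd])
  then have "continuous_map (prod_topology ?YI unit_interval) euclideanreal
      (\<lambda>w. max \<bar>2 * snd (fst w) - 1\<bar> (snd w))"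
    by (intro continuous_intros)
  moreover have "continuous_map (prod_topology ?YI unit_interval) Y (\<lambda>w. fst (fst w))"
    using continuous_map_compose[OF continuous_map_fst continuous_map_fst] by (simp add: o_def)
  ultimately have "continuous_map (prod_topology ?YI unit_interval) ?YI
      (\<lambda>w. (fst (fst w), max \<bar>2 * snd (fst w) - 1\<bar> (snd w)))"
    by (auto simp: continuous_map_pairwise o_def continuous_map_in_subtopology)
  from continuous_map_compose[OF continuous_map_compose[OF this h] pc]
  have H: "continuous_map (prod_topology ?YI unit_interval) B H"
    by (simp add: H_def o_def case_prod_unfold)
  have u: "continuous_map ?YI euclideanreal u"
    unfolding u_def using vf snd by (intro continuous_intros) auto
  have u1: "0 \<le> u z \<and> u z \<le> 1" if "z \<in> topspace ?YI" for z
    using that v(2)[of "fst z"] by (auto simp: u_def intro!: mult_nonneg_nonneg mult_le_one)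
  have H0: "H (z, 0) = p (\<gamma> z)" if "z \<in> topspace ?YI" for z
    using that hk by (auto simp: H_def \<gamma>_def)
  have H1: "H (z, 1) = p (h (fst z, 0))" if "z \<in> topspace ?YI" for z
  proof -
    have "max \<bar>2 * snd z - 1\<bar> 1 = 1" using that by auto
    then show ?thesis using that ends by (auto simp: H_def)
  qed
  have stat: "H (z, t) = H (z, 0)" if "z \<in> topspace ?YI" "u z = 0" "t \<in> {0..1}" for z t
  proof -
    have "fst z \<in> D \<or> snd z = 0 \<or> snd z = 1" using u0 that by blast
    then show ?thesis
    proof (elim disjE)
      assume D': "fst z \<in> D"
      have I: "max \<bar>2 * snd z - 1\<bar> t \<in> {0..1}" "max \<bar>2 * snd z - 1\<bar> 0 \<in> {0..1}"
        using that by auto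
      show ?thesis
        unfolding H_def by (simp only: split const[OF D' I(1)] const[OF D' I(2)])
    next
      assume "snd z = 0"
      then have "max \<bar>2 * snd z - 1\<bar> t = 1" "max \<bar>2 * snd z - 1\<bar> 0 = 1"
        using that(3) by auto
      then show ?thesis by (simp only: H_def split)
    next
      assume "snd z = 1"
      then have "max \<bar>2 * snd z - 1\<bar> t = 1" "max \<bar>2 * snd z - 1\<bar> 0 = 1"
        using that(3) by auto
      then show ?thesis by (simp only: H_def split)
    qed
  qed
  obtain G where G: "continuous_map (prod_topology ?YI unit_interval) E G"
    "\<And>z. z \<in> topspace ?YI \<Longrightarrow> G (z, 0) = \<gamma> z"
    "\<And>z t. z \<in> topspace ?YI \<Longrightarrow> t \<in> {0..1} \<Longrightarrow> p (G (z, t)) = H (z, t)"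
    "\<And>z t. z \<in> topspace ?YI \<Longrightarrow> u z = 0 \<Longrightarrow> t \<in> {0..1} \<Longrightarrow> G (z, t) = \<gamma> z"
    using homotopy_lifting_property_relative[OF hurewicz_fibration_lifting[OF fib] u u1 \<gamma> H H0 stat]
    by blast
  define \<sigma> where "\<sigma> y = (\<lambda>s\<in>{0..1}. G ((y, s), 1))" for y
  have "continuous_map ?YI (prod_topology ?YI unit_interval) (\<lambda>z. (z, 1))"
    by (simp add: continuous_map_pairwise o_def)
  from continuous_map_compose[OF this G(1)]
  have "continuous_map Y (path_space E) \<sigma>"
    unfolding \<sigma>_def using path_space_curry[of Y E "\<lambda>z. G (z, 1)"] by (simp add: o_def)
  moreover have "(\<lambda>t. p (\<sigma> y t)) constant_on {0..1}" if "y \<in> topspace Y" for y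
    unfolding constant_on_def
  proof (intro exI[of _ "p (h (y, 0))"] ballI)
    fix s :: real assume s: "s \<in> {0..1}"
    then show "p (\<sigma> y s) = p (h (y, 0))"
      using G(3)[of "(y, s)" 1] H1[of "(y, s)"] that by (simp add: \<sigma>_def)
  qed
  ultimately have \<sigma>: "continuous_map Y (vertical_path_space E p) \<sigma>"
    unfolding vertical_path_space_def by (auto simp: continuous_map_in_subtopology)
  have G1: "\<sigma> y s = \<gamma> (y, s)" if "y \<in> topspace Y" "s \<in> {0..1}" "y \<in> D \<or> s = 0 \<or> s = 1" for y s
    using G(4)[of "(y, s)" 1] u0[of "(y, s)"] that by (auto simp: \<sigma>_def)
  show ?thesis
  proof
    show "continuous_map Y (vertical_path_space E p) \<sigma>" by fact
    show "endpoints (\<sigma> y) = (h (y, 1), k (y, 1))" if "y \<in> topspace Y" for y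
      using G1[OF that, of 0] G1[OF that, of 1] by (simp add: endpoints_def \<gamma>_def)
    show "\<sigma> y = const_path (h (y, 0))" if "y \<in> D" for y
    proof
      fix s
      have "y \<in> topspace Y" using that D closedin_subset by blast
      then show "\<sigma> y s = const_path (h (y, 0)) s"
        using G1[of y s] that const[OF that, of "1 - 2 * s"] const[OF that, of "2 * s - 1"]
        by (cases "s \<in> {0..1}") (auto simp: const_path_def \<gamma>_def \<sigma>_def)
    qed
  qed
qed

section \<open>Local sections and covers\<close>

lemma topspace_fibre_square:
  "topspace (fibre_square E p) = {(x, y). x \<in> topspace E \<and> y \<in> topspace E \<and> p x = p y}"
  by (auto simp: fibre_square_def)

lemma diagonal_subset_fibre_square: "diagonal E \<subseteq> topspace (fibre_square E p)"
  by (auto simp: diagonal_def topspace_fibre_square)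

lemma closedin_fibre_square_diagonal:
  assumes "Hausdorff_space E"
  shows "closedin (fibre_square E p) (diagonal E)"
proof -
  have "diagonal E = (\<lambda>x. (x, x)) ` topspace E"
    by (auto simp: diagonal_def)
  then have "closedin (prod_topology E E) (diagonal E)"
    using assms Hausdorff_space_closedin_diagonal by metis
  then show ?thesis
    unfolding fibre_square_def by (rule closedin_subset_topspace) (auto simp: diagonal_def)
qed

lemma local_section_subset:
  assumes "local_section E p U \<sigma>" "V \<subseteq> U"
  shows "local_section E p V \<sigma>"
  using assms unfolding local_section_def
  by (meson continuous_map_from_subtopology_mono subsetD)

text \<open>On disjoint open sets pasting requires no compatibility of the sections.\<close>

lemma local_section_disjoint_Un:
  assumes U: "openin (fibre_square E p) U" "local_section E p U \<sigma>"
    and V: "openin (fibre_square E p) V" "local_section E p V \<tau>" and "U \<inter> V = {}"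
  shows "local_section E p (U \<union> V) (\<lambda>z. if z \<in> V then \<tau> z else \<sigma> z)"
  unfolding local_section_def
proof
  let ?X = "fibre_square E p" and ?S = "\<lambda>b. if b then V else U"
  have sub: "(U \<union> V) \<inter> ?S b = ?S b" for b by auto
  show "continuous_map (subtopology ?X (U \<union> V)) (vertical_path_space E p) (\<lambda>z. if z \<in> V then \<tau> z else \<sigma> z)"
  proof (rule pasting_lemma[of UNIV _ ?S _ "\<lambda>b. if b then \<tau> else \<sigma>"])
    show "openin (subtopology ?X (U \<union> V)) (?S b)" for b
      unfolding openin_subtopology using U V sub[of b] by (intro exI[of _ "?S b"]) auto
    show "continuous_map (subtopology (subtopology ?X (U \<union> V)) (?S b)) (vertical_path_space E p) (if b then \<tau> else \<sigma>)" for b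
      unfolding subtopology_subtopology sub using U V by (auto simp: local_section_def)
    fix z assume z: "z \<in> topspace (subtopology ?X (U \<union> V))"
    show "\<exists>b. b \<in> UNIV \<and> z \<in> ?S b \<and> (if z \<in> V then \<tau> z else \<sigma> z) = (if b then \<tau> else \<sigma>) z"
      using z by (intro exI[of _ "z \<in> V"]) auto
  qed (use \<open>U \<inter> V = {}\<close> in \<open>auto split: if_splits\<close>)
  show "\<forall>u\<in>U \<union> V. endpoints (if u \<in> V then \<tau> u else \<sigma> u) = u"
    using U V by (auto simp: local_section_def)
qed

text \<open>
  A section over \<open>A\<close> is a homotopy over \<open>A\<close> from \<open>z \<mapsto> (fst z, fst z)\<close> to the inclusion, and both maps
  are defined on the whole fibre square.
\<close>

proposition local_section_open_extension:
  assumes fib: "hurewicz_fibration E B p" and X: "ANR_space (fibre_square E p)"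
    and A: "A \<subseteq> topspace (fibre_square E p)" and \<sigma>: "local_section E p A \<sigma>"
    and D: "closedin (fibre_square E p) D" "D \<subseteq> A" "D \<subseteq> diagonal E"
    and const: "\<And>e. (e, e) \<in> D \<Longrightarrow> \<sigma> (e, e) = const_path e"
  obtains V \<tau> where "openin (fibre_square E p) V" "A \<subseteq> V" "local_section E p V \<tau>"
    "\<And>e. (e, e) \<in> D \<Longrightarrow> \<tau> (e, e) = const_path e"
proof -
  let ?X = "fibre_square E p"
  have mX: "metrizable_space ?X" using X by (simp add: ANR_space_def)
  let ?AI = "prod_topology (subtopology ?X A) unit_interval"
  \<comment> \<open>The first coordinate is held fixed while the second follows the path;
    verticality of \<open>\<sigma> z\<close> keeps the pair in the fibre square.\<close>
  define h where "h = (\<lambda>(z, t). (fst z, \<sigma> z t))"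
  have \<sigma>c: "continuous_map (subtopology ?X A) (path_space E) \<sigma>"
    using \<sigma> by (auto simp: local_section_def vertical_path_space_def continuous_map_in_subtopology)
  have vert: "(\<lambda>t. p (\<sigma> z t)) constant_on {0..1}" if "z \<in> A" for z
    using \<sigma> A that
    by (fastforce simp: local_section_def vertical_path_space_def continuous_map_in_subtopology)
  have ends: "\<sigma> z 0 = fst z" "\<sigma> z 1 = snd z" if "z \<in> A" for z
    using \<sigma> that by (auto simp: local_section_def endpoints_def prod_eq_iff)
  have fstX: "continuous_map ?X E fst" and sndX: "continuous_map ?X E snd"
    unfolding fibre_square_def
    by (auto intro: continuous_map_from_subtopology continuous_map_fst continuous_map_snd)
  have "continuous_map ?AI (prod_topology (path_space E) unit_interval) (\<lambda>z. (\<sigma> (fst z), snd z))"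
    using continuous_map_compose[OF continuous_map_fst \<sigma>c]
    by (simp add: continuous_map_pairwise o_def continuous_map_snd)
  from continuous_map_compose[OF this path_space_eval]
  have "continuous_map ?AI E (\<lambda>z. \<sigma> (fst z) (snd z))"
    by (simp add: o_def)
  moreover have "continuous_map ?AI E (\<lambda>z. fst (fst z))"
    using continuous_map_compose[OF continuous_map_fst continuous_map_from_subtopology[OF fstX]]
    by (simp add: o_def)
  moreover have "p (fst z) = p (\<sigma> z t)" if "z \<in> A" "t \<in> {0..1}" for z t
    using vert[OF that(1)] ends(1)[OF that(1)] that(2) unfolding constant_on_def
    by (metis atLeastAtMost_iff order_refl zero_le_one)
  ultimately have h: "continuous_map ?AI ?X h"
    unfolding fibre_square_def
    by (auto simp: h_def continuous_map_in_subtopology continuous_map_pairwise o_def case_prod_unfold)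
  have f0: "continuous_map ?X ?X (\<lambda>z. (fst z, fst z))"
    using fstX unfolding fibre_square_def
    by (auto simp: continuous_map_in_subtopology continuous_map_pairwise o_def)
  have f1: "continuous_map ?X ?X (\<lambda>z. z)" by simp
  have h0: "h (z, 0) = (fst z, fst z)" and h1: "h (z, 1) = z" if "z \<in> A" for z
    using ends[OF that] by (auto simp: h_def)
  have hD: "h (z, t) = z" if "z \<in> D" "t \<in> {0..1}" for z t
    using that D(3) const by (auto simp: h_def diagonal_def const_path_def)
  obtain V H where V: "openin ?X V" "A \<subseteq> V"
    and H: "continuous_map (prod_topology (subtopology ?X V) unit_interval) ?X H"
    and H0: "\<And>z. z \<in> V \<Longrightarrow> H (z, 0) = (fst z, fst z)" and H1: "\<And>z. z \<in> V \<Longrightarrow> H (z, 1) = z"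
    and HD: "\<And>z t. z \<in> D \<Longrightarrow> t \<in> {0..1} \<Longrightarrow> H (z, t) = z"
    using ANR_space_homotopy_extension[OF X mX A D(1,2) f0 f1 h h0 h1 hD] by blast
  let ?Y = "subtopology ?X V"
  have topY: "topspace ?Y = V"
    using openin_subset[OF V(1)] by auto
  have HX: "H (z, t) \<in> topspace ?X" if "z \<in> V" "t \<in> {0..1}" for z t
    using continuous_map_image_subset_topspace[OF H] topY that by (auto simp: image_subset_iff)
  have DY: "closedin ?Y D"
    using D V by (auto intro: closedin_subset_topspace)
  have pH: "p ((fst \<circ> H) (z, t)) = p ((snd \<circ> H) (z, t))" if "z \<in> topspace ?Y" "t \<in> {0..1}" for z t
    using HX[of z t] that unfolding topY by (auto simp: topspace_fibre_square)
  have H0': "(fst \<circ> H) (z, 0) = (snd \<circ> H) (z, 0)" if "z \<in> topspace ?Y" for z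
    using H0 that unfolding topY by simp
  \<comment> \<open>The prescribed ends \<open>(fst z, fst z)\<close> and \<open>z\<close> have the
    same first coordinate, so the first component of \<open>H\<close> runs along a loop.\<close>
  have pH': "p ((fst \<circ> H) (z, 1)) = p ((fst \<circ> H) (z, 0))" if "z \<in> topspace ?Y" for z
    using H0 H1 that unfolding topY by simp
  have HD': "(fst \<circ> H) (z, t) = (fst \<circ> H) (z, 0) \<and> (snd \<circ> H) (z, t) = (fst \<circ> H) (z, 0)"
    if "z \<in> D" "t \<in> {0..1}" for z t
    using HD[OF that] HD[OF that(1), of 0] that D(3) by (auto simp: diagonal_def)
  obtain \<tau> where \<tau>: "continuous_map ?Y (vertical_path_space E p) \<tau>"
      "\<And>z. z \<in> topspace ?Y \<Longrightarrow> endpoints (\<tau> z) = ((fst \<circ> H) (z, 1), (snd \<circ> H) (z, 1))"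
      "\<And>z. z \<in> D \<Longrightarrow> \<tau> z = const_path ((fst \<circ> H) (z, 0))"
    using vertical_path_of_double_path[OF fib metrizable_space_subtopology[OF mX] DY
        continuous_map_compose[OF H fstX] continuous_map_compose[OF H sndX] pH H0' pH' HD']
    by blast
  show ?thesis
  proof
    show "local_section E p V \<tau>"
      using \<tau>(1,2) H1 unfolding local_section_def topY by simp
    show "\<tau> (e, e) = const_path e" if "(e, e) \<in> D" for e
      using \<tau>(3)[OF that] HD[OF that, of 0] by simp
  qed (use V in auto)
qed

section \<open>Converting the three kinds of covers into each other\<close>

lemma FH_cover_open_refinement:
  assumes fib: "hurewicz_fibration E B p" and E: "Hausdorff_space E"
    and X: "ANR_space (fibre_square E p)" and U: "FH_cover E p k U"
  obtains V where "\<forall>i\<le>k. openin (fibre_square E p) (V i)" "FH_cover E p k V"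
proof -
  let ?X = "fibre_square E p"
  note \<Delta> = closedin_fibre_square_diagonal[OF E, of p]
  obtain \<sigma> where cover: "topspace ?X = (\<Union>i\<le>k. U i)"
    and \<sigma>: "\<And>i. i \<le> k \<Longrightarrow> local_section E p (U i) (\<sigma> i)" and U0: "diagonal E \<subseteq> U 0"
    and \<sigma>0: "\<And>e. e \<in> topspace E \<Longrightarrow> \<sigma> 0 (e, e) = const_path e"
    and disj: "\<And>i. i \<in> {1..k} \<Longrightarrow> diagonal E \<inter> U i = {}"
    using U unfolding FH_cover_def by blast
  \<comment> \<open>The set of index 0 is enlarged relative to the whole diagonal. The implication
    stands under the quantifiers so that choice yields families indexed by all naturals.\<close>
  have "\<exists>V \<tau>. i \<le> k \<longrightarrow> openin ?X V \<and> U i \<subseteq> V \<and> local_section E p V \<tau> \<and>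
     (if i = 0 then \<forall>e \<in> topspace E. \<tau> (e, e) = const_path e else diagonal E \<inter> V = {})" for i
  proof (cases "i \<le> k")
    case True
    have Ui: "U i \<subseteq> topspace ?X" using cover True by auto
    show ?thesis
    proof (cases "i = 0")
      case True
      have "\<sigma> i (e, e) = const_path e" if "(e, e) \<in> diagonal E" for e
        using \<sigma>0 that by (auto simp: diagonal_def True)
      moreover have "diagonal E \<subseteq> U i" using U0 True by simp
      ultimately obtain V \<tau> where "openin ?X V" "U i \<subseteq> V" "local_section E p V \<tau>"
          "\<And>e. (e, e) \<in> diagonal E \<Longrightarrow> \<tau> (e, e) = const_path e"
        using local_section_open_extension[OF fib X Ui \<sigma>[OF \<open>i \<le> k\<close>] \<Delta>] by blast
      then show ?thesis using True by (fastforce simp: diagonal_def)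
    next
      case False
      \<comment> \<open>No stationarity is prescribed here, so the closed part is empty. The
        enlarged set may meet the diagonal, which is closed and can be removed again without losing
        points of \<open>U i\<close>.\<close>
      obtain V \<tau> where V: "openin ?X V" "U i \<subseteq> V" "local_section E p V \<tau>"
        using local_section_open_extension[OF fib X Ui \<sigma>[OF \<open>i \<le> k\<close>], of "{}"] by auto
      have "local_section E p (V - diagonal E) \<tau>"
        using V(3) by (rule local_section_subset) auto
      moreover have "openin ?X (V - diagonal E)" using V(1) \<Delta> by (rule openin_diff)
      moreover have "U i \<subseteq> V - diagonal E" using V(2) disj[of i] False True by auto
      ultimately show ?thesis using False by (intro exI[of _ "V - diagonal E"] exI[of _ \<tau>]) auto
    qed
  qed auto
  then obtain V \<tau> where V: "\<And>i. i \<le> k \<Longrightarrow> openin ?X (V i) \<and> U i \<subseteq> V i \<and> local_section E p (V i) (\<tau> i) \<and>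
     (if i = 0 then \<forall>e \<in> topspace E. \<tau> i (e, e) = const_path e else diagonal E \<inter> V i = {})"
    by metis
  show ?thesis
  proof
    show "\<forall>i\<le>k. openin ?X (V i)" using V by blast
    have "topspace ?X = (\<Union>i\<le>k. V i)"
      using cover V openin_subset by fastforce
    moreover have "diagonal E \<subseteq> V 0" "\<forall>e \<in> topspace E. \<tau> 0 (e, e) = const_path e"
      using V[of 0] U0 by auto
    moreover have "diagonal E \<inter> V i = {}" if "i \<in> {1..k}" for i
      using V[of i] that by simp
    moreover have "\<forall>i\<le>k. local_section E p (V i) (\<tau> i)"
      using V by simp
    ultimately show "FH_cover E p k V"
      unfolding FH_cover_def by blast
  qed
qed

text \<open>By normality the closed diagonal has a neighbourhood \<open>W\<close> whose closure lies
  in \<open>U 0\<close>. Removing that closure from \<open>U i\<close> leaves an open set disjoint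
  from \<open>W\<close>, so on the union \<open>\<sigma> i\<close> and \<open>\<sigma> 0\<close> can
  be used side by side.\<close>

lemma FH_cover_imp_monoidal_cover:
  assumes E: "Hausdorff_space E" and X: "normal_space (fibre_square E p)"
    and open_U: "\<forall>i\<le>k. openin (fibre_square E p) (U i)" and U: "FH_cover E p k U"
  shows "\<exists>V \<tau>. topspace (fibre_square E p) = (\<Union>i\<le>k. V i) \<and>
     (\<forall>i\<le>k. openin (fibre_square E p) (V i) \<and> diagonal E \<subseteq> V i \<and>
             local_section E p (V i) (\<tau> i) \<and> (\<forall>e \<in> topspace E. \<tau> i (e, e) = const_path e))"
proof -
  let ?X = "fibre_square E p"
  obtain \<sigma> where cover: "topspace ?X = (\<Union>i\<le>k. U i)"
    and \<sigma>: "\<And>i. i \<le> k \<Longrightarrow> local_section E p (U i) (\<sigma> i)" and U0: "diagonal E \<subseteq> U 0"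
    and \<sigma>0: "\<And>e. e \<in> topspace E \<Longrightarrow> \<sigma> 0 (e, e) = const_path e"
    using U unfolding FH_cover_def by blast
  have "openin ?X (U 0)" using open_U by simp
  then obtain W where W: "openin ?X W" "diagonal E \<subseteq> W" "?X closure_of W \<subseteq> U 0"
    using X[unfolded normal_space_alt, rule_format, of "diagonal E" "U 0"]
      closedin_fibre_square_diagonal[OF E, of p] U0 by auto
  have WW: "W \<subseteq> ?X closure_of W"
    using W(1) by (simp add: closure_of_subset openin_subset)
  \<comment> \<open>The part of \<open>U i\<close> lost in the closure of \<open>W\<close> is covered by \<open>U 0\<close>.\<close>
  define V where "V i = (if i = 0 then U 0 else (U i - ?X closure_of W) \<union> W)" for i
  define \<tau> where "\<tau> i z = (if i = 0 \<or> z \<in> W then \<sigma> 0 z else \<sigma> i z)" for i z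
  have "topspace ?X = (\<Union>i\<le>k. V i)"
  proof
    have "V i \<subseteq> topspace ?X" if "i \<le> k" for i
      using openin_subset[OF open_U[rule_format, OF that]] openin_subset[OF W(1)] by (auto simp: V_def)
    then show "(\<Union>i\<le>k. V i) \<subseteq> topspace ?X" by blast
    show "topspace ?X \<subseteq> (\<Union>i\<le>k. V i)"
    proof
      fix z assume "z \<in> topspace ?X"
      then obtain i where i: "i \<le> k" "z \<in> U i" using cover by blast
      have "z \<in> V 0 \<or> z \<in> V i" using i W(3) by (auto simp: V_def)
      then show "z \<in> (\<Union>i\<le>k. V i)" using i by auto
    qed
  qed
  moreover have "openin ?X (V i)" if "i \<le> k" for i
    using that open_U W(1) by (auto simp: V_def intro!: openin_Un openin_diff)
  moreover have "diagonal E \<subseteq> V i" for i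
    using U0 W by (auto simp: V_def)
  moreover have "local_section E p (V i) (\<tau> i)" if i: "i \<le> k" for i
  proof (cases "i = 0")
    case True
    then show ?thesis using \<sigma>[of 0] by (simp add: V_def \<tau>_def[abs_def])
  next
    case False
    have "local_section E p (U i - ?X closure_of W) (\<sigma> i)"
      using \<sigma>[OF i] by (rule local_section_subset) auto
    moreover have "local_section E p W (\<sigma> 0)"
      using \<sigma>[of 0] WW W(3) by (auto intro: local_section_subset)
    moreover have "openin ?X (U i - ?X closure_of W)"
      using open_U i by (auto intro: openin_diff)
    ultimately have "local_section E p ((U i - ?X closure_of W) \<union> W) (\<lambda>z. if z \<in> W then \<sigma> 0 z else \<sigma> i z)"
      using WW W(1) by (intro local_section_disjoint_Un) auto
    then show ?thesis using False by (simp add: V_def \<tau>_def[abs_def])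
  qed
  moreover have "\<tau> i (e, e) = const_path e" if "e \<in> topspace E" for i e
    using that \<sigma>0 W(2) by (auto simp: \<tau>_def diagonal_def)
  ultimately show ?thesis
    by (intro exI[of _ V] exI[of _ \<tau>]) auto
qed

text \<open>The diagonal is closed and contained in \<open>U 0\<close>, so it can be removed from
  all other sets without destroying openness or the covering.\<close>

lemma monoidal_cover_imp_FH_cover:
  assumes E: "Hausdorff_space E" and cover: "topspace (fibre_square E p) = (\<Union>i\<le>k. U i)"
    and U: "\<forall>i\<le>k. openin (fibre_square E p) (U i) \<and> diagonal E \<subseteq> U i \<and>
             local_section E p (U i) (\<sigma> i) \<and> (\<forall>e \<in> topspace E. \<sigma> i (e, e) = const_path e)"
  shows "\<exists>V. (\<forall>i\<le>k. openin (fibre_square E p) (V i)) \<and> FH_cover E p k V"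
proof -
  define V where "V i = (if i = 0 then U 0 else U i - diagonal E)" for i
  have sub: "V i \<subseteq> U i" for i by (auto simp: V_def)
  have op: "openin (fibre_square E p) (V i)" if "i \<le> k" for i
    using U that closedin_fibre_square_diagonal[OF E, of p] unfolding V_def by (simp add: openin_diff)
  have "(\<Union>i\<le>k. U i) \<subseteq> (\<Union>i\<le>k. V i)"
  proof
    fix z assume "z \<in> (\<Union>i\<le>k. U i)"
    then obtain i where i: "i \<le> k" "z \<in> U i" by blast
    moreover have "diagonal E \<subseteq> U 0" using U by simp
    ultimately have "z \<in> V 0 \<or> z \<in> V i" by (auto simp: V_def)
    then show "z \<in> (\<Union>i\<le>k. V i)" using i(1) by auto
  qed
  moreover have "(\<Union>i\<le>k. V i) \<subseteq> (\<Union>i\<le>k. U i)"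
    by (rule UN_mono) (use sub in auto)
  ultimately have "topspace (fibre_square E p) = (\<Union>i\<le>k. V i)"
    unfolding cover by (rule equalityI)
  moreover have "local_section E p (V i) (\<sigma> i)" if "i \<le> k" for i
    by (rule local_section_subset[OF _ sub]) (use U that in simp)
  moreover have "diagonal E \<subseteq> V 0" "\<forall>e \<in> topspace E. \<sigma> 0 (e, e) = const_path e"
    using U by (simp_all add: V_def)
  moreover have "diagonal E \<inter> V i = {}" if "i \<in> {1..k}" for i
    using that by (auto simp: V_def)
  ultimately have "FH_cover E p k V"
    unfolding FH_cover_def by (intro conjI exI[of _ \<sigma>]) simp_all
  with op show ?thesis by blast
qed

theorem theorem3p27:
  fixes E :: "'e topology" and B :: "'b topology" and p :: "'e \<Rightarrow> 'b"
  assumes "hurewicz_fibration E B p"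
    and "ANR_space E"
    and "ANR_space (fibre_square E p)"
  shows "TC_g_FH E p = TC_FH E p \<and> TC_FH E p = TC_M E p"
proof
  have E: "Hausdorff_space E"
    using assms(2) by (simp add: ANR_space_def metrizable_imp_Hausdorff_space)
  have X: "normal_space (fibre_square E p)"
    using assms(3) by (simp add: ANR_space_def metrizable_imp_normal_space)
  \<comment> \<open>The invariants are compared by showing that the same \<open>k\<close> are
    admissible. The infima then agree even when no \<open>k\<close> is.\<close>
  have "(\<exists>U. FH_cover E p k U) \<longleftrightarrow>
      (\<exists>U. (\<forall>i\<le>k. openin (fibre_square E p) (U i)) \<and> FH_cover E p k U)" for k
    by (metis FH_cover_open_refinement[OF assms(1) E assms(3)])
  then show "TC_g_FH E p = TC_FH E p"
    unfolding TC_g_FH_def TC_FH_def by simp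
  have "(\<exists>U. (\<forall>i\<le>k. openin (fibre_square E p) (U i)) \<and> FH_cover E p k U) \<longleftrightarrow>
      (\<exists>U \<sigma>. topspace (fibre_square E p) = (\<Union>i\<le>k. U i) \<and>
       (\<forall>i\<le>k. openin (fibre_square E p) (U i) \<and> diagonal E \<subseteq> U i \<and>
             local_section E p (U i) (\<sigma> i) \<and>
             (\<forall>e \<in> topspace E. \<sigma> i (e, e) = const_path e)))" (is "?FH k \<longleftrightarrow> ?M k") for k
  proof
    assume "?FH k"
    then show "?M k" by (elim exE conjE) (rule FH_cover_imp_monoidal_cover[OF E X])
  next
    assume "?M k"
    then show "?FH k" by (elim exE conjE) (rule monoidal_cover_imp_FH_cover[OF E])
  qed
  then show "TC_FH E p = TC_M E p"
    unfolding TC_FH_def TC_M_def by simp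
qed

end
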